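(* Let $p$ be a prime number and let $r$ be a natural number. If the elementary abelian group $(\mathbb{Z}_p)^r$ is not a DCI group, then $(\mathbb{Z}_p)^{r+3}$ is not a CI group.
   Context: Let $G$ be a finite group. For a subset $S \subseteq G$, the Cayley digraph $\overrightarrow{\mathrm{Cay}}(G;S)$ is the directed graph with vertex set $G$ and with a directed edge $g \to h$ if and only if $h \in Sg$ (loops are allowed, i.e. $S$ may contain the identity). If $S = S^{-1}$ ($S$ is symmetric), it can be viewed as an undirected graph, called a Cayley graph and denoted $\mathrm{Cay}(G;S)$. A Cayley digraph $\overrightarrow{\mathrm{Cay}}(G;S)$ is a DCI digraph if, for every subset $S'$ of $G$ such that $\overrightarrow{\mathrm{Cay}}(G;S) \cong \overrightarrow{\mathrm{Cay}}(G;S')$, there is a group automorphism $\alpha$ of $G$ with $\alpha(S)=S'$. A Cayley graph $\mathrm{Cay}(G;S)$ is a CI graph if, for every symmetric subset $S'$ of $G$ such that $\mathrm{Cay}(G;S) \cong \mathrm{Cay}(G;S')$, there is a group automorphism $\alpha$ of $G$ with $\alpha(S)=S'$. $G$ is a DCI group if every Cayley digraph of $G$ is a DCI digraph, and $G$ is a CI group if every (undirected) Cayley graph of $G$ is a CI graph. *)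

theory Defs
  imports
    "HOL-Computational_Algebra.Primes"
    "HOL-Algebra.Product_Groups"
    "Graph_Theory.Pair_Digraph"
    "Graph_Theory.Digraph_Isomorphism"
begin

text \<open>
  The standing assumption that \<open>G\<close> is a finite group is not built into these definitions.
\<close>

definition cayley_digraph ::
  "('a, 'b) monoid_scheme \<Rightarrow> 'a set \<Rightarrow> ('a, 'a \<times> 'a) pre_digraph" where
  "cayley_digraph G S =
     with_proj \<lparr>pverts = carrier G, parcs = {(g, h). g \<in> carrier G \<and> h \<in> S #>\<^bsub>G\<^esub> g}\<rparr>"

definition symmetric_subset :: "('a, 'b) monoid_scheme \<Rightarrow> 'a set \<Rightarrow> bool" where
  "symmetric_subset G S \<longleftrightarrow> S \<subseteq> carrier G \<and> set_inv\<^bsub>G\<^esub> S = S"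

definition DCI_digraph :: "('a, 'b) monoid_scheme \<Rightarrow> 'a set \<Rightarrow> bool" where
  "DCI_digraph G S \<longleftrightarrow>
     (\<forall>S'. S' \<subseteq> carrier G \<longrightarrow> digraph_iso (cayley_digraph G S) (cayley_digraph G S') \<longrightarrow>
        (\<exists>\<alpha> \<in> iso G G. \<alpha> ` S = S'))"

text \<open>
  As in \<^theory>\<open>Graph_Theory.Digraph\<close>, undirected graphs are symmetric digraphs: for symmetric \<open>S\<close> the
  Cayley graph is the Cayley digraph of \<open>S\<close>, and isomorphism of Cayley graphs is isomorphism of
  the symmetric digraphs.
\<close>

definition CI_graph :: "('a, 'b) monoid_scheme \<Rightarrow> 'a set \<Rightarrow> bool" where
  "CI_graph G S \<longleftrightarrow>
     (\<forall>S'. symmetric_subset G S' \<longrightarrow> digraph_iso (cayley_digraph G S) (cayley_digraph G S') \<longrightarrow>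
        (\<exists>\<alpha> \<in> iso G G. \<alpha> ` S = S'))"

definition DCI_group :: "('a, 'b) monoid_scheme \<Rightarrow> bool" where
  "DCI_group G \<longleftrightarrow> (\<forall>S. S \<subseteq> carrier G \<longrightarrow> DCI_digraph G S)"

definition CI_group :: "('a, 'b) monoid_scheme \<Rightarrow> bool" where
  "CI_group G \<longleftrightarrow> (\<forall>S. symmetric_subset G S \<longrightarrow> CI_graph G S)"

definition Zp_power :: "nat \<Rightarrow> nat \<Rightarrow> (nat \<Rightarrow> int) monoid" where
  "Zp_power p r = product_group {..<r} (\<lambda>_. integer_mod_group p)"

lemma group_Zp_power: "group (Zp_power p r)"
  by (simp add: Zp_power_def)

lemma finite_Zp_power: "p > 0 \<Longrightarrow> finite (carrier (Zp_power p r))"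
  by (auto simp: Zp_power_def carrier_integer_mod_group intro!: finite_PiE)

lemma arcs_cayley_digraph:
  "(g, h) \<in> arcs (cayley_digraph G S) \<longleftrightarrow> g \<in> carrier G \<and> (\<exists>s\<in>S. h = s \<otimes>\<^bsub>G\<^esub> g)"
  by (auto simp: cayley_digraph_def r_coset_def)

text \<open>
  The library notion of isomorphism also carries maps on arcs, tails and heads; on Cayley digraphs
  it amounts to a bijection of the vertices that preserves adjacency in both directions.
\<close>

lemma digraph_iso_cayley_digraph_iff:
  assumes "group G" "S \<subseteq> carrier G" "S' \<subseteq> carrier G"
  shows "digraph_iso (cayley_digraph G S) (cayley_digraph G S') \<longleftrightarrow>
    (\<exists>f. bij_betw f (carrier G) (carrier G) \<and>
      (\<forall>g\<in>carrier G. \<forall>h\<in>carrier G. h \<in> S #>\<^bsub>G\<^esub> g \<longleftrightarrow> f h \<in> S' #>\<^bsub>G\<^esub> f g))" (is "?L \<longleftrightarrow> ?R")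
proof -
  interpret group G by fact
  let ?A = "\<lambda>T. {(g, h). g \<in> carrier G \<and> h \<in> T #>\<^bsub>G\<^esub> g}"
  have sub: "?A T \<subseteq> carrier G \<times> carrier G" if "T \<subseteq> carrier G" for T
    using that by (auto simp: r_coset_def)
  have sel: "verts (cayley_digraph G T) = carrier G" "arcs (cayley_digraph G T) = ?A T"
    "tail (cayley_digraph G T) = fst" "head (cayley_digraph G T) = snd" for T
    by (simp_all add: cayley_digraph_def)
  have wf: "wf_digraph (cayley_digraph G S)"
    by unfold_locales (use sub[OF assms(2)] in \<open>auto simp: sel\<close>)
  show ?thesis
  proof
    assume ?L
    then obtain k where k: "pre_digraph.digraph_isomorphism (cayley_digraph G S) k"
      and eq: "cayley_digraph G S' = app_iso k (cayley_digraph G S)"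
      by (auto simp: digraph_iso_def)
    define f where "f = iso_verts k"
    have inj: "inj_on f (carrier G)"
      using k by (simp add: pre_digraph.digraph_isomorphism_def sel f_def)
    have im: "f ` carrier G = carrier G"
      using arg_cong[OF eq, of verts] by (simp add: sel f_def)
    have th: "iso_tail k = fst" "iso_head k = snd"
      using arg_cong[OF eq, of tail] arg_cong[OF eq, of head] by (simp_all add: sel)
    have arc: "iso_arcs k a = (f (fst a), f (snd a))" if "a \<in> ?A S" for a
    proof -
      have "f (fst a) = fst (iso_arcs k a) \<and> f (snd a) = snd (iso_arcs k a)"
        using k that unfolding pre_digraph.digraph_isomorphism_def sel th f_def by blast
      then show ?thesis by (simp add: prod_eq_iff)
    qed
    have "?A S' = iso_arcs k ` ?A S"
      using arg_cong[OF eq, of arcs] by (simp add: sel)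
    also have "\<dots> = map_prod f f ` ?A S"
    proof (rule image_cong[OF refl])
      fix a assume "a \<in> ?A S"
      from arc[OF this] show "iso_arcs k a = map_prod f f a" by (cases a) simp
    qed
    finally have A: "?A S' = map_prod f f ` ?A S" .
    have "h \<in> S #>\<^bsub>G\<^esub> g \<longleftrightarrow> f h \<in> S' #>\<^bsub>G\<^esub> f g" if gh: "g \<in> carrier G" "h \<in> carrier G" for g h
    proof -
      have "f g \<in> carrier G" using gh im by blast
      then have "f h \<in> S' #>\<^bsub>G\<^esub> f g \<longleftrightarrow> (f g, f h) \<in> ?A S'" by simp
      also have "\<dots> \<longleftrightarrow> map_prod f f (g, h) \<in> map_prod f f ` ?A S" unfolding A by simp
      also have "\<dots> \<longleftrightarrow> (g, h) \<in> ?A S"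
        by (rule inj_on_image_mem_iff[OF map_prod_inj_on[OF inj inj] _ sub[OF assms(2)]])
          (use gh in simp)
      finally show ?thesis using gh by simp
    qed
    with inj im show ?R by (auto simp: bij_betw_def)
  next
    assume ?R
    then obtain f where f: "bij_betw f (carrier G) (carrier G)"
      and ff: "\<And>g h. g \<in> carrier G \<Longrightarrow> h \<in> carrier G \<Longrightarrow> h \<in> S #>\<^bsub>G\<^esub> g \<longleftrightarrow> f h \<in> S' #>\<^bsub>G\<^esub> f g"
      by blast
    have inj: "inj_on f (carrier G)" and im: "f ` carrier G = carrier G"
      using f by (auto simp: bij_betw_def)
    define k where
      "k = \<lparr>iso_verts = f, iso_arcs = map_prod f f, iso_head = snd, iso_tail = fst\<rparr>"
    have "inj_on (map_prod f f) (?A S)"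
      by (rule inj_on_subset[OF map_prod_inj_on[OF inj inj] sub[OF assms(2)]])
    then have "pre_digraph.digraph_isomorphism (cayley_digraph G S) k"
      using wf inj by (simp add: pre_digraph.digraph_isomorphism_def sel k_def)
    moreover have "?A S' = map_prod f f ` ?A S"
    proof (rule Set.set_eqI, rule iffI)
      fix x assume x: "x \<in> ?A S'"
      then have "x \<in> f ` carrier G \<times> f ` carrier G" using sub[OF assms(3)] unfolding im by blast
      then obtain g h where gh: "x = (f g, f h)" "g \<in> carrier G" "h \<in> carrier G" by blast
      with x have "(g, h) \<in> ?A S" by (simp add: ff)
      then show "x \<in> map_prod f f ` ?A S"
        by (rule rev_image_eqI) (simp add: gh)
    next
      fix x assume "x \<in> map_prod f f ` ?A S"
      then obtain g h where gh: "(g, h) \<in> ?A S" "x = (f g, f h)" by auto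
      then have c: "g \<in> carrier G" "h \<in> carrier G" using sub[OF assms(2)] by blast+
      then have "f g \<in> carrier G" using im by blast
      with gh c show "x \<in> ?A S'" by (simp add: ff)
    qed
    then have "cayley_digraph G S' = app_iso k (cayley_digraph G S)"
      by (intro pre_digraph.equality) (auto simp: sel k_def im)
    ultimately show ?L by (auto simp: digraph_iso_def)
  qed
qed

end

(* For p = 2 every subset is symmetric, so CI and DCI agree, and CI passes to direct factors.
   For odd p write the larger group as V x W with W = Z_p^3. A connection set S of V that violates
   DCI is turned into a symmetric set by placing S in the layer over w = (1,1,1) and S^-1 over -w,
   all of V over the coordinate planes, and {1} over the six other vectors with entries 1 and -1.
   A subgroup of order |V| p^2 inside this set contains V x {1}; as V x {1} is the intersection
   of the three subgroups over the coordinate planes, an automorphism matching two such sets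
   preserves it. It also matches the singleton layers, and w is the sum of the three vectors with
   one entry -1, so it maps the layer over w onto S' or S'^-1 without any translation. *)

theory Submission
  imports Defs
begin

text \<open>The obstacle is that an automorphism of V x W may mix the factors. It need not preserve
  V x {1}; and even if it does, it acts on the coset over u as an automorphism A of V followed by
  the translation by some c(u), so that over w it would match S with a translate only. The full
  layers serve to cure the first defect, the singleton layers the second: c is a homomorphism from W
  to V, and each singleton {1} must go to a singleton {1}, so c is trivial at the vectors carrying
  them and hence at their sum. The origin of rank three: with n coordinates, the n vectors that
  arise from (1,...,1) by changing one sign add up to n - 2 times (1,...,1), which for n = 3 is w
  itself. That the two symmetric sets give isomorphic graphs is the easy half. A bijection f that
  matches S with S' also matches S^-1 with S'^-1, V with V and {1} with {1}, so f on V together with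
  the identity on W respects every layer.\<close>

section \<open>Isomorphisms of Cayley digraphs as bijections compatible with quotients\<close>

text \<open>Adjacency is expressed through the quotient \<open>h \<otimes> inv g\<close> instead of
  a coset, because quotients in a direct product are computed componentwise and so show which layer
  an arc uses.\<close>

definition cayley_iso ::
  "('a, 'b) monoid_scheme \<Rightarrow> 'a set \<Rightarrow> 'a set \<Rightarrow> ('a \<Rightarrow> 'a) \<Rightarrow> bool" where
  "cayley_iso G S S' f \<longleftrightarrow> bij_betw f (carrier G) (carrier G) \<and>
     (\<forall>g\<in>carrier G. \<forall>h\<in>carrier G. h \<otimes>\<^bsub>G\<^esub> inv\<^bsub>G\<^esub> g \<in> S \<longleftrightarrow> f h \<otimes>\<^bsub>G\<^esub> inv\<^bsub>G\<^esub> (f g) \<in> S')"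

lemma cayley_isoD:
  assumes "cayley_iso G S S' f"
  shows "bij_betw f (carrier G) (carrier G)"
    and "\<lbrakk>g \<in> carrier G; h \<in> carrier G\<rbrakk> \<Longrightarrow>
      h \<otimes>\<^bsub>G\<^esub> inv\<^bsub>G\<^esub> g \<in> S \<longleftrightarrow> f h \<otimes>\<^bsub>G\<^esub> inv\<^bsub>G\<^esub> (f g) \<in> S'"
    and "g \<in> carrier G \<Longrightarrow> f g \<in> carrier G"
  using assms by (auto simp: cayley_iso_def bij_betw_def)

lemma (in group) mem_r_coset_iff:
  assumes "S \<subseteq> carrier G" "g \<in> carrier G" "h \<in> carrier G"
  shows "h \<in> S #> g \<longleftrightarrow> h \<otimes> inv g \<in> S"
proof
  assume "h \<in> S #> g"
  then obtain s where s: "s \<in> S" "h = s \<otimes> g" by (auto simp: r_coset_def)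
  with assms have "h \<otimes> inv g = s" by (auto simp: m_assoc)
  with s show "h \<otimes> inv g \<in> S" by simp
next
  assume *: "h \<otimes> inv g \<in> S"
  have "h = (h \<otimes> inv g) \<otimes> g" using assms by (simp add: m_assoc)
  with * show "h \<in> S #> g" unfolding r_coset_def by blast
qed

lemma digraph_iso_cayley_digraph_iff_cayley_iso:
  assumes "group G" "S \<subseteq> carrier G" "S' \<subseteq> carrier G"
  shows "digraph_iso (cayley_digraph G S) (cayley_digraph G S') \<longleftrightarrow> (\<exists>f. cayley_iso G S S' f)"
proof -
  have "h \<in> S #>\<^bsub>G\<^esub> g \<longleftrightarrow> h \<otimes>\<^bsub>G\<^esub> inv\<^bsub>G\<^esub> g \<in> S"
    and "bij_betw f (carrier G) (carrier G) \<Longrightarrow>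
      f h \<in> S' #>\<^bsub>G\<^esub> f g \<longleftrightarrow> f h \<otimes>\<^bsub>G\<^esub> inv\<^bsub>G\<^esub> (f g) \<in> S'"
    if "g \<in> carrier G" "h \<in> carrier G" for g h and f :: "'a \<Rightarrow> 'a"
    using that by (simp_all add: group.mem_r_coset_iff[OF assms(1)] assms bij_betwE)
  then show ?thesis
    unfolding digraph_iso_cayley_digraph_iff[OF assms] cayley_iso_def by blast
qed

lemma DCI_group_iff_cayley_iso:
  assumes "group G"
  shows "DCI_group G \<longleftrightarrow>
    (\<forall>S S' f. S \<subseteq> carrier G \<longrightarrow> S' \<subseteq> carrier G \<longrightarrow> cayley_iso G S S' f \<longrightarrow> (\<exists>\<alpha>\<in>iso G G. \<alpha> ` S = S'))"
  by (simp add: DCI_group_def DCI_digraph_def digraph_iso_cayley_digraph_iff_cayley_iso[OF assms])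

lemma CI_group_iff_cayley_iso:
  assumes "group G"
  shows "CI_group G \<longleftrightarrow>
    (\<forall>S S' f. symmetric_subset G S \<longrightarrow> symmetric_subset G S' \<longrightarrow> cayley_iso G S S' f \<longrightarrow>
      (\<exists>\<alpha>\<in>iso G G. \<alpha> ` S = S'))"
  by (simp add: CI_group_def CI_graph_def symmetric_subset_def
      digraph_iso_cayley_digraph_iff_cayley_iso[OF assms])

lemma (in group) symmetric_subset_iff:
  "symmetric_subset G S \<longleftrightarrow> S \<subseteq> carrier G \<and> (\<forall>x\<in>S. inv x \<in> S)"
proof -
  have "set_inv S = S" if "S \<subseteq> carrier G" "\<forall>x\<in>S. inv x \<in> S"
  proof
    show "set_inv S \<subseteq> S" using that by (auto simp: SET_INV_def)
    show "S \<subseteq> set_inv S"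
    proof
      fix x assume "x \<in> S"
      with that have "inv x \<in> S" "x = inv (inv x)" by auto
      then show "x \<in> set_inv S" unfolding SET_INV_def by blast
    qed
  qed
  then show ?thesis by (auto simp: symmetric_subset_def SET_INV_def)
qed

lemma (in group) cayley_iso_one_mem:
  assumes "cayley_iso G S S' f"
  shows "\<one> \<in> S \<longleftrightarrow> \<one> \<in> S'"
  using cayley_isoD(2)[OF assms one_closed one_closed] cayley_isoD(3)[OF assms one_closed]
  by simp

text \<open>\<open>S\<close> is the set of out-neighbours of \<open>\<one>\<close>, and
  \<open>f\<close> carries it to the out-neighbours of \<open>f \<one>\<close>. As
  \<open>f \<one>\<close> need not be the identity, \<open>?g\<close> translates the result back,
  giving a bijection from \<open>S\<close> to \<open>S'\<close>.\<close>

lemma (in group) cayley_iso_card: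
  assumes f: "cayley_iso G S S' f" and "S \<subseteq> carrier G" "S' \<subseteq> carrier G"
  shows "card S = card S'"
proof -
  let ?g = "\<lambda>h. f h \<otimes> inv (f \<one>)"
  have fb: "bij_betw f (carrier G) (carrier G)" by (rule cayley_isoD(1)[OF f])
  have f1: "f \<one> \<in> carrier G" by (rule cayley_isoD(3)[OF f one_closed])
  have "bij_betw (\<lambda>x. x \<otimes> inv (f \<one>)) (carrier G) (carrier G)"
    by (rule bij_betw_byWitness[where f' = "\<lambda>x. x \<otimes> f \<one>"]) (use f1 in \<open>auto simp: m_assoc\<close>)
  then have gb: "bij_betw ?g (carrier G) (carrier G)"
    using bij_betw_trans[OF fb] by (simp add: comp_def)
  have mem: "h \<in> S \<longleftrightarrow> ?g h \<in> S'" if "h \<in> carrier G" for h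
    using cayley_isoD(2)[OF f one_closed that] that by simp
  have "?g ` S = S'"
  proof
    show "?g ` S \<subseteq> S'" using mem assms(2) by blast
    show "S' \<subseteq> ?g ` S"
    proof
      fix y assume "y \<in> S'"
      then obtain h where "h \<in> carrier G" "y = ?g h"
        using gb assms(3) unfolding bij_betw_def by blast
      with mem \<open>y \<in> S'\<close> show "y \<in> ?g ` S" by blast
    qed
  qed
  moreover have "inj_on ?g S" using gb assms(2) by (auto simp: bij_betw_def intro: inj_on_subset)
  ultimately show ?thesis by (metis card_image)
qed

lemma cayley_iso_compl:
  assumes "group G" "cayley_iso G S S' f"
  shows "cayley_iso G (carrier G - S) (carrier G - S') f"
proof -
  interpret group G by fact
  show ?thesis
    using assms(2) unfolding cayley_iso_def by (auto simp: bij_betw_def)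
qed

text \<open>Membership of \<open>\<one>\<close> only decides whether there is a loop at every vertex
  or at none, and an injective \<open>f\<close> preserves both equality and inequality of end
  points.\<close>

lemma (in group) cayley_iso_insert_one:
  assumes "cayley_iso G S S' f"
  shows "cayley_iso G (insert \<one> S) (insert \<one> S') f"
    and "cayley_iso G (S - {\<one>}) (S' - {\<one>}) f"
proof -
  have "h \<otimes> inv g = \<one> \<longleftrightarrow> h = g" if "g \<in> carrier G" "h \<in> carrier G" for g h
    using that inv_equality[of h "inv g"] r_inv by auto
  moreover have "f h = f g \<longleftrightarrow> h = g" if "g \<in> carrier G" "h \<in> carrier G" for g h
    using cayley_isoD(1)[OF assms] that by (auto simp: bij_betw_def inj_on_def)
  ultimately have *: "h \<otimes> inv g = \<one> \<longleftrightarrow> f h \<otimes> inv (f g) = \<one>"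
    if "g \<in> carrier G" "h \<in> carrier G" for g h
    using that cayley_isoD(3)[OF assms] by metis
  show "cayley_iso G (insert \<one> S) (insert \<one> S') f" "cayley_iso G (S - {\<one>}) (S' - {\<one>}) f"
    using assms * unfolding cayley_iso_def by auto
qed

lemma iso_image_compl:
  assumes "\<alpha> \<in> iso G G" "S \<subseteq> carrier G" "S' \<subseteq> carrier G"
    and "\<alpha> ` (carrier G - S) = carrier G - S'"
  shows "\<alpha> ` S = S'"
proof -
  have inj: "inj_on \<alpha> (carrier G)" and im: "\<alpha> ` carrier G = carrier G"
    using assms(1) by (auto simp: iso_def bij_betw_def)
  have "\<alpha> ` S = \<alpha> ` (carrier G - (carrier G - S))" using assms(2) by (simp add: double_diff)
  also have "\<dots> = carrier G - (carrier G - S')"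
    using inj_on_image_set_diff[OF inj, of "carrier G" "carrier G - S"] im assms(4) by simp
  finally show ?thesis using assms(3) by (simp add: double_diff)
qed

section \<open>Transport of the CI property, and its descent to a direct factor\<close>

text \<open>Connection sets and digraph isomorphisms of \<open>K\<close> are pulled back to
  \<open>G\<close> by conjugating with \<open>\<phi>\<close>; the automorphism found there is
  conjugated back. This allows the main argument to be run in an explicit direct product.\<close>

lemma CI_group_iso:
  assumes "group G" "group K" "G \<cong> K" "CI_group G"
  shows "CI_group K"
proof -
  interpret G: group G by fact
  interpret K: group K by fact
  from assms(3) obtain \<phi> where phi: "\<phi> \<in> iso G K" by (auto simp: is_iso_def)
  define \<psi> where "\<psi> = inv_into (carrier G) \<phi>"
  have psi: "\<psi> \<in> iso K G" unfolding \<psi>_def by (rule G.iso_set_sym[OF phi])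
  interpret psi: group_hom K G \<psi>
    by unfold_locales (use psi in \<open>simp add: iso_def\<close>)
  interpret phi: group_hom G K \<phi>
    by unfold_locales (use phi in \<open>simp add: iso_def\<close>)
  have bphi: "bij_betw \<phi> (carrier G) (carrier K)" and bpsi: "bij_betw \<psi> (carrier K) (carrier G)"
    using phi psi by (auto simp: iso_def)
  have pp: "\<phi> (\<psi> x) = x" if "x \<in> carrier K" for x
    unfolding \<psi>_def using bij_betw_inv_into_right[OF bphi that] .
  have pp': "\<psi> (\<phi> x) = x" if "x \<in> carrier G" for x
    unfolding \<psi>_def using bij_betw_inv_into_left[OF bphi that] .
  show ?thesis
    unfolding CI_group_iff_cayley_iso[OF assms(2)]
  proof (intro allI impI)
    fix S S' f
    assume S: "symmetric_subset K S" and S': "symmetric_subset K S'" and f: "cayley_iso K S S' f"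
    have sub: "S \<subseteq> carrier K" "S' \<subseteq> carrier K" using S S' by (auto simp: symmetric_subset_def)
    have symm: "symmetric_subset G (\<psi> ` T)" if "symmetric_subset K T" for T
      using that unfolding K.symmetric_subset_iff G.symmetric_subset_iff
      by (auto simp flip: psi.hom_inv)
    have mem: "x \<in> \<psi> ` T \<longleftrightarrow> \<phi> x \<in> T" if "T \<subseteq> carrier K" "x \<in> carrier G" for T x
      using that pp pp' by (metis (no_types, lifting) imageE image_eqI subsetD)
    let ?f = "\<psi> \<circ> f \<circ> \<phi>"
    have "bij_betw ?f (carrier G) (carrier G)"
      using bphi bpsi cayley_isoD(1)[OF f] by (metis bij_betw_trans comp_assoc)
    moreover have "h \<otimes>\<^bsub>G\<^esub> inv\<^bsub>G\<^esub> g \<in> \<psi> ` S \<longleftrightarrow> ?f h \<otimes>\<^bsub>G\<^esub> inv\<^bsub>G\<^esub> (?f g) \<in> \<psi> ` S'"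
      if "g \<in> carrier G" "h \<in> carrier G" for g h
      using that cayley_isoD(2)[OF f, of "\<phi> g" "\<phi> h"] cayley_isoD(3)[OF f, of "\<phi> g"]
        cayley_isoD(3)[OF f, of "\<phi> h"]
      by (simp add: mem sub pp)
    ultimately have "cayley_iso G (\<psi> ` S) (\<psi> ` S') ?f" by (simp add: cayley_iso_def)
    then obtain \<alpha> where a: "\<alpha> \<in> iso G G" "\<alpha> ` \<psi> ` S = \<psi> ` S'"
      using assms(4)[unfolded CI_group_iff_cayley_iso[OF assms(1)], rule_format,
          OF symm[OF S] symm[OF S']] by blast
    have "\<phi> \<circ> \<alpha> \<circ> \<psi> \<in> iso K K"
      using iso_set_trans[OF psi iso_set_trans[OF a(1) phi]] by (simp add: comp_assoc)
    moreover have "(\<phi> \<circ> \<alpha> \<circ> \<psi>) ` S = S'"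
    proof -
      have "(\<phi> \<circ> \<alpha> \<circ> \<psi>) ` S = \<phi> ` \<psi> ` S'" by (simp only: image_comp[symmetric] a(2))
      also have "\<dots> = (\<lambda>x. x) ` S'"
        unfolding image_image by (rule image_cong) (use sub(2) pp in auto)
      finally show ?thesis by simp
    qed
    ultimately show "\<exists>\<alpha>\<in>iso K K. \<alpha> ` S = S'" by blast
  qed
qed

text \<open>The identity on \<open>W\<close> leaves the second component of each quotient unchanged,
  so an arc stays in its layer, where \<open>f\<close> decides. One single \<open>f\<close> has to
  serve all layers at once.\<close>

lemma cayley_iso_DirProd:
  assumes "group V" "group W" "bij_betw f (carrier V) (carrier V)"
    and "\<And>u. u \<in> carrier W \<Longrightarrow> cayley_iso V (L u) (L' u) f"
  shows "cayley_iso (V \<times>\<times> W) {(v, u). u \<in> carrier W \<and> v \<in> L u}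
    {(v, u). u \<in> carrier W \<and> v \<in> L' u} (map_prod f id)"
proof -
  interpret V: group V by fact
  interpret W: group W by fact
  have "bij_betw (map_prod f id) (carrier (V \<times>\<times> W)) (carrier (V \<times>\<times> W))"
    using bij_betw_map_prod[OF assms(3) bij_betw_id[of "carrier W"]] by simp
  moreover have "(h, w) \<otimes>\<^bsub>V \<times>\<times> W\<^esub> inv\<^bsub>V \<times>\<times> W\<^esub> (g, u) \<in> {(v, u). u \<in> carrier W \<and> v \<in> L u} \<longleftrightarrow>
      (f h, w) \<otimes>\<^bsub>V \<times>\<times> W\<^esub> inv\<^bsub>V \<times>\<times> W\<^esub> (f g, u) \<in> {(v, u). u \<in> carrier W \<and> v \<in> L' u}"
    if "g \<in> carrier V" "u \<in> carrier W" "h \<in> carrier V" "w \<in> carrier W" for g u h w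
    using that cayley_isoD(2)[OF assms(4), of "w \<otimes>\<^bsub>W\<^esub> inv\<^bsub>W\<^esub> u" g h] bij_betwE[OF assms(3)]
    by (simp add: inv_DirProd[OF assms(1,2)])
  ultimately show ?thesis
    unfolding cayley_iso_def by simp
qed

text \<open>An automorphism that maps \<open>V \<times> {\<one>}\<close> into itself is injective
  there, and finiteness turns this restriction into an automorphism of \<open>V\<close>.\<close>

lemma iso_fst_DirProd:
  assumes V: "group V" and W: "group W" and "finite (carrier V)"
    and a: "\<alpha> \<in> iso (V \<times>\<times> W) (V \<times>\<times> W)"
    and s: "\<And>v. v \<in> carrier V \<Longrightarrow> snd (\<alpha> (v, \<one>\<^bsub>W\<^esub>)) = \<one>\<^bsub>W\<^esub>"
  shows "(\<lambda>v. fst (\<alpha> (v, \<one>\<^bsub>W\<^esub>))) \<in> iso V V"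
proof -
  interpret V: group V by fact
  interpret W: group W by fact
  let ?A = "\<lambda>v. fst (\<alpha> (v, \<one>\<^bsub>W\<^esub>))"
  have ah: "\<alpha> \<in> hom (V \<times>\<times> W) (V \<times>\<times> W)" and ab: "inj_on \<alpha> (carrier V \<times> carrier W)"
    using a by (auto simp: iso_def bij_betw_def)
  have A_closed: "?A v \<in> carrier V" if "v \<in> carrier V" for v
    using hom_in_carrier[OF ah, of "(v, \<one>\<^bsub>W\<^esub>)"] that by auto
  have "?A (v \<otimes>\<^bsub>V\<^esub> w) = ?A v \<otimes>\<^bsub>V\<^esub> ?A w" if "v \<in> carrier V" "w \<in> carrier V" for v w
    using hom_mult[OF ah, of "(v, \<one>\<^bsub>W\<^esub>)" "(w, \<one>\<^bsub>W\<^esub>)"] that by (simp add: mult_DirProd')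
  with A_closed have "?A \<in> hom V V" by (auto simp: hom_def)
  moreover have inj: "inj_on ?A (carrier V)"
  proof (rule inj_onI)
    fix v w assume vw: "v \<in> carrier V" "w \<in> carrier V" "?A v = ?A w"
    then have "\<alpha> (v, \<one>\<^bsub>W\<^esub>) = \<alpha> (w, \<one>\<^bsub>W\<^esub>)" using s by (simp add: prod_eq_iff)
    with vw show "v = w" using inj_onD[OF ab] by auto
  qed
  moreover have "?A ` carrier V = carrier V"
    by (rule endo_inj_surj[OF assms(3) image_subsetI[OF A_closed] inj])
  ultimately show ?thesis by (simp add: iso_def bij_betw_def)
qed

text \<open>An automorphism that matches \<open>S \<times> {\<one>}\<close> with
  \<open>S' \<times> {\<one>}\<close> may move \<open>V \<times> {\<one>}\<close> as a whole. But
  the \<open>v\<close> for which the image of \<open>(v, \<one>)\<close> stays in that factor form a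
  subgroup of \<open>V\<close> containing \<open>S\<close>, and \<open>gen\<close> makes this
  subgroup everything.\<close>

lemma iso_of_CI_group_DirProd_generating:
  assumes V: "group V" and W: "group W" and fin: "finite (carrier V)"
    and CI: "CI_group (V \<times>\<times> W)"
    and S: "symmetric_subset V S" and S': "symmetric_subset V S'" and f: "cayley_iso V S S' f"
    and gen: "\<And>H. subgroup H V \<Longrightarrow> S \<subseteq> H \<Longrightarrow> H = carrier V"
  shows "\<exists>\<alpha>\<in>iso V V. \<alpha> ` S = S'"
proof -
  interpret V: group V by fact
  interpret W: group W by fact
  interpret P: group "V \<times>\<times> W" by (rule DirProd_group[OF V W])
  let ?T = "\<lambda>S. S \<times> {\<one>\<^bsub>W\<^esub>}"
  have sym: "symmetric_subset (V \<times>\<times> W) (?T R)" if "symmetric_subset V R" for R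
    using that unfolding V.symmetric_subset_iff P.symmetric_subset_iff
    by (auto simp: inv_DirProd[OF V W] subset_iff)
  \<comment> \<open>Seen as a layered set, all layers off the identity of \<open>W\<close> are
    empty, and any bijection is an isomorphism between empty connection sets.\<close>
  have T_eq: "?T R = {(v, u). u \<in> carrier W \<and> v \<in> (if u = \<one>\<^bsub>W\<^esub> then R else {})}" for R
    by auto
  have "cayley_iso (V \<times>\<times> W) (?T S) (?T S') (map_prod f id)"
    unfolding T_eq
    by (rule cayley_iso_DirProd[OF V W cayley_isoD(1)[OF f]])
      (use f in \<open>auto simp: cayley_iso_def\<close>)
  then obtain \<alpha> where a: "\<alpha> \<in> iso (V \<times>\<times> W) (V \<times>\<times> W)" and aT: "\<alpha> ` ?T S = ?T S'"
    using CI[unfolded CI_group_iff_cayley_iso[OF P.group_axioms], rule_format,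
        OF sym[OF S] sym[OF S']] by blast
  interpret a: group_hom "V \<times>\<times> W" "V \<times>\<times> W" \<alpha>
    by unfold_locales (use a in \<open>simp add: iso_def\<close>)
  define H where "H = {v \<in> carrier V. snd (\<alpha> (v, \<one>\<^bsub>W\<^esub>)) = \<one>\<^bsub>W\<^esub>}"
  have "subgroup H V"
  proof
    show "\<one>\<^bsub>V\<^esub> \<in> H" using a.hom_one by (simp add: H_def)
    show "v \<otimes>\<^bsub>V\<^esub> w \<in> H" if "v \<in> H" "w \<in> H" for v w
      using that a.hom_mult[of "(v, \<one>\<^bsub>W\<^esub>)" "(w, \<one>\<^bsub>W\<^esub>)"] by (simp add: H_def mult_DirProd')
    show "inv\<^bsub>V\<^esub> v \<in> H" if "v \<in> H" for v
    proof -
      have v: "v \<in> carrier V" "snd (\<alpha> (v, \<one>\<^bsub>W\<^esub>)) = \<one>\<^bsub>W\<^esub>" using that by (auto simp: H_def)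
      obtain x y where xy: "\<alpha> (v, \<one>\<^bsub>W\<^esub>) = (x, y)" by fastforce
      have "(x, y) \<in> carrier (V \<times>\<times> W)" using a.hom_closed[of "(v, \<one>\<^bsub>W\<^esub>)"] v xy by simp
      then show ?thesis
        using a.hom_inv[of "(v, \<one>\<^bsub>W\<^esub>)"] v xy by (simp add: H_def inv_DirProd[OF V W])
    qed
  qed (simp add: H_def)
  moreover have *: "\<alpha> (v, \<one>\<^bsub>W\<^esub>) \<in> ?T S'" if "v \<in> S" for v
    using that unfolding aT[symmetric] by simp
  have "S \<subseteq> H"
  proof
    fix v assume "v \<in> S"
    moreover have "v \<in> carrier V" using \<open>v \<in> S\<close> S by (auto simp: symmetric_subset_def)
    ultimately show "v \<in> H" using *[of v] by (auto simp: H_def)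
  qed
  ultimately have H: "H = carrier V" by (rule gen)
  have "fst ` \<alpha> ` ?T S = (\<lambda>v. fst (\<alpha> (v, \<one>\<^bsub>W\<^esub>))) ` S" by (force simp: image_image)
  moreover have "fst ` ?T S' = S'" by (force simp: image_image)
  ultimately have "(\<lambda>v. fst (\<alpha> (v, \<one>\<^bsub>W\<^esub>))) ` S = S'" using aT by simp
  moreover have "(\<lambda>v. fst (\<alpha> (v, \<one>\<^bsub>W\<^esub>))) \<in> iso V V"
    by (rule iso_fst_DirProd[OF V W fin a]) (use H in \<open>auto simp: H_def\<close>)
  ultimately show ?thesis by blast
qed

text \<open>For a fixed \<open>x\<close> outside \<open>H\<close> and any \<open>h\<close> in
  \<open>H\<close>, both \<open>x\<close> and \<open>x \<otimes> h\<close> lie outside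
  \<open>H\<close>, hence in \<open>H'\<close>, and \<open>h\<close> is their quotient.\<close>

lemma (in group) subgroup_containing_compl:
  assumes H: "subgroup H G" "H \<noteq> carrier G" and H': "subgroup H' G" "carrier G - H \<subseteq> H'"
  shows "H' = carrier G"
proof -
  have sub: "H \<subseteq> carrier G" "H' \<subseteq> carrier G" using H H' subgroup.subset by blast+
  with H obtain x where x: "x \<in> carrier G" "x \<notin> H" by blast
  have "h \<in> H'" if "h \<in> H" for h
  proof -
    have hc: "h \<in> carrier G" using that sub by blast
    have "x \<otimes> h \<notin> H"
    proof
      assume "x \<otimes> h \<in> H"
      then have "(x \<otimes> h) \<otimes> inv h \<in> H"
        using that H(1) by (blast intro: subgroup.m_closed subgroup.m_inv_closed)
      with x hc show False by (simp add: m_assoc)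
    qed
    then have "x \<otimes> h \<in> H'" "x \<in> H'" using H'(2) x hc by auto
    then have "inv x \<otimes> (x \<otimes> h) \<in> H'"
      using H'(1) by (blast intro: subgroup.m_closed subgroup.m_inv_closed)
    moreover have "inv x \<otimes> (x \<otimes> h) = h" using x hc by (simp flip: m_assoc)
    ultimately show ?thesis by simp
  qed
  with H'(2) sub show ?thesis by blast
qed

text \<open>
  If \<open>S\<close> lies in a proper subgroup, its complement generates the group; so one of \<open>S \<times> {1}\<close> and
  \<open>(V - S) \<times> {1}\<close> generates the factor \<open>V \<times> {1}\<close>, which any automorphism matching the sets then
  preserves.
\<close>

lemma CI_group_DirProd_left:
  assumes V: "group V" and W: "group W" and fin: "finite (carrier V)"
    and CI: "CI_group (V \<times>\<times> W)"
  shows "CI_group V"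
  unfolding CI_group_iff_cayley_iso[OF V]
proof (intro allI impI)
  interpret V: group V by fact
  fix S S' f
  assume S: "symmetric_subset V S" and S': "symmetric_subset V S'" and f: "cayley_iso V S S' f"
  show "\<exists>\<alpha>\<in>iso V V. \<alpha> ` S = S'"
  proof (cases "\<exists>H. subgroup H V \<and> S \<subseteq> H \<and> H \<noteq> carrier V")
    case False
    then show ?thesis
      by (intro iso_of_CI_group_DirProd_generating[OF V W fin CI S S' f]) blast
  next
    case True
    then obtain H where H: "subgroup H V" "S \<subseteq> H" "H \<noteq> carrier V" by blast
    have sym: "symmetric_subset V (carrier V - R)" if "symmetric_subset V R" for R
      using that unfolding V.symmetric_subset_iff by (metis Diff_iff Diff_subset V.inv_closed V.inv_inv)
    have "\<exists>\<alpha>\<in>iso V V. \<alpha> ` (carrier V - S) = carrier V - S'"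
      by (rule iso_of_CI_group_DirProd_generating[OF V W fin CI sym[OF S] sym[OF S']
            cayley_iso_compl[OF V f]])
        (use H V.subgroup_containing_compl[of H] in blast)
    then obtain \<alpha> where \<alpha>: "\<alpha> \<in> iso V V" "\<alpha> ` (carrier V - S) = carrier V - S'" ..
    have "S \<subseteq> carrier V" "S' \<subseteq> carrier V" using S S' by (simp_all add: symmetric_subset_def)
    from iso_image_compl[OF \<alpha>(1) this \<alpha>(2)] \<alpha>(1) show ?thesis ..
  qed
qed

section \<open>Normalising a counterexample to the DCI property\<close>

lemma (in comm_group) iso_m_inv: "(\<lambda>x. inv x) \<in> iso G G"
proof -
  have "bij_betw (\<lambda>x. inv x) (carrier G) (carrier G)"
    by (rule bij_betw_byWitness[where f' = "\<lambda>x. inv x"]) auto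
  then show ?thesis by (simp add: iso_def hom_def inv_mult)
qed

text \<open>The layers carrying \<open>S\<close> must later be told apart from singleton and full
  layers, and must not contain the identity. Removing \<open>\<one>\<close> from both sets is
  harmless, since it lies in both or in neither and automorphisms fix it. If only one element
  remains, the complement of \<open>insert \<one> S\<close> is used instead.\<close>

lemma (in comm_group) DCI_counterexample_large:
  assumes fin: "finite (carrier G)" and "\<not> DCI_group G"
  obtains S S' f where "S \<subseteq> carrier G" "S' \<subseteq> carrier G" "cayley_iso G S S' f" "\<one> \<notin> S" "\<one> \<notin> S'"
    "2 \<le> card S" "\<not> (\<exists>\<alpha>\<in>iso G G. \<alpha> ` S = S')"
proof -
  let ?C = "carrier G"
  obtain S\<^sub>0 S\<^sub>0' f where *: "S\<^sub>0 \<subseteq> ?C" "S\<^sub>0' \<subseteq> ?C" "cayley_iso G S\<^sub>0 S\<^sub>0' f"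
    "\<not> (\<exists>\<alpha>\<in>iso G G. \<alpha> ` S\<^sub>0 = S\<^sub>0')"
    using assms(2) unfolding DCI_group_iff_cayley_iso[OF group_axioms] by blast
  define S where "S = S\<^sub>0 - {\<one>}"
  define S' where "S' = S\<^sub>0' - {\<one>}"
  have sub: "S \<subseteq> ?C" "S' \<subseteq> ?C" and one: "\<one> \<notin> S" "\<one> \<notin> S'" using * by (auto simp: S_def S'_def)
  have finS: "finite S" "finite S'" using sub fin finite_subset by blast+
  have f: "cayley_iso G S S' f" unfolding S_def S'_def by (rule cayley_iso_insert_one(2)[OF *(3)])
  have card_eq: "card S = card S'" by (rule cayley_iso_card[OF f sub])
  have iso_one: "\<alpha> \<one> = \<one>" if "\<alpha> \<in> iso G G" for \<alpha>
    using that hom_one[OF _ group_axioms group_axioms] by (auto simp: iso_def)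
  have no: "\<alpha> ` S \<noteq> S'" if "\<alpha> \<in> iso G G" for \<alpha>
  proof
    assume "\<alpha> ` S = S'"
    moreover have "S\<^sub>0 = (if \<one> \<in> S\<^sub>0 then insert \<one> S else S)" by (auto simp: S_def)
    moreover have "S\<^sub>0' = (if \<one> \<in> S\<^sub>0 then insert \<one> S' else S')"
      using cayley_iso_one_mem[OF *(3)] by (auto simp: S'_def)
    ultimately have "\<alpha> ` S\<^sub>0 = S\<^sub>0'" using iso_one[OF that] by (metis image_insert)
    with * that show False by blast
  qed
  have id: "(\<lambda>x. x) \<in> iso G G" by (rule iso_set_refl)
  have ne: "S \<noteq> S'" using no[OF id] by simp
  show thesis
  proof (cases "2 \<le> card S")
    case True
    with sub f one no that show thesis by blast
  next
    case False
    have "card S \<noteq> 0" using ne card_eq finS by (metis card_0_eq)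
    with False have "card S = 1" "card S' = 1" using card_eq by auto
    then obtain s s' where s: "S = {s}" "S' = {s'}" by (meson card_1_singletonE)
    let ?R = "?C - insert \<one> S" and ?R' = "?C - insert \<one> S'"
    have g: "cayley_iso G ?R ?R' f"
      by (intro cayley_iso_compl cayley_iso_insert_one(1) f group_axioms)
    have noR: "\<not> (\<exists>\<alpha>\<in>iso G G. \<alpha> ` ?R = ?R')"
    proof
      assume "\<exists>\<alpha>\<in>iso G G. \<alpha> ` ?R = ?R'"
      then obtain \<alpha> where a: "\<alpha> \<in> iso G G" "\<alpha> ` ?R = ?R'" by blast
      then have im: "\<alpha> ` insert \<one> S = insert \<one> S'"
        using iso_image_compl[of \<alpha> G "insert \<one> S" "insert \<one> S'"] sub by blast
      have nt: "\<alpha> x \<noteq> \<one>" if "x \<in> S" for x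
      proof
        assume "\<alpha> x = \<one>"
        then have "\<alpha> x = \<alpha> \<one>" using iso_one[OF a(1)] by simp
        moreover have "inj_on \<alpha> ?C" using a(1) by (simp add: iso_def bij_betw_def)
        ultimately have "x = \<one>" using that sub by (meson inj_onD one_closed subsetD)
        with one that show False by blast
      qed
      have "\<one> \<notin> \<alpha> ` S" using nt by (metis imageE)
      with im have "\<alpha> ` S = S'" using iso_one[OF a(1)] one by (simp add: insert_ident)
      with no a show False by blast
    qed
    \<comment> \<open>Otherwise the group consists of \<open>\<one>\<close>, \<open>s\<close> and
      \<open>s'\<close> only; then \<open>s'\<close> is the inverse of \<open>s\<close>, and
      inversion would be an automorphism matching \<open>S\<close> with \<open>S'\<close>.\<close>
    have "2 \<le> card ?R"
    proof (rule ccontr)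
      assume "\<not> 2 \<le> card ?R"
      then have "\<forall>x\<in>?R. \<forall>y\<in>?R. x = y"
        using card_le_Suc0_iff_eq[of ?R] fin by simp
      moreover have ss: "s' \<in> ?R" "s \<in> ?C" "s \<noteq> \<one>" "s' \<in> ?C" "s' \<noteq> \<one>"
        using ne s sub one by auto
      ultimately have R: "x = s'" if "x \<in> ?R" for x using that by blast
      have C: "x = \<one> \<or> x = s \<or> x = s'" if "x \<in> ?C" for x using that R s(1) by blast
      have "s \<otimes> s' \<in> ?C" using ss by simp
      moreover have "s \<otimes> s' \<noteq> s" "s \<otimes> s' \<noteq> s'" using ss by auto
      ultimately have "s \<otimes> s' = \<one>" using C by blast
      then have "s' \<otimes> s = \<one>" using ss by (simp add: m_comm)
      then have "inv s = s'" using ss by (simp add: inv_equality)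
      then have "(\<lambda>x. inv x) ` S = S'" using s by simp
      with iso_m_inv show False using no by blast
    qed
    with g noR that[of ?R ?R' f] show thesis by auto
  qed
qed

section \<open>Subgroups of the product that contain the left factor\<close>

text \<open>This is the counting behind image and kernel of the projection to \<open>W\<close>: with
  \<open>s u\<close> a chosen first component over \<open>u\<close>, an element of \<open>X\<close>
  is determined by its second component and its deviation from \<open>s\<close>, which lies in the
  kernel.\<close>

lemma card_subgroup_DirProd_le:
  assumes V: "group V" and W: "group W" and fin: "finite (carrier V)"
    and X: "subgroup X (V \<times>\<times> W)" "finite X"
  shows "card X \<le> card (snd ` X) * card {v \<in> carrier V. (v, \<one>\<^bsub>W\<^esub>) \<in> X}"
proof -
  interpret V: group V by fact
  interpret W: group W by fact
  let ?K = "{v \<in> carrier V. (v, \<one>\<^bsub>W\<^esub>) \<in> X}"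
  define s where "s u = (SOME v. (v, u) \<in> X)" for u
  have s: "(s (snd x), snd x) \<in> X" if "x \<in> X" for x
    unfolding s_def by (rule someI[of "\<lambda>v. (v, snd x) \<in> X" "fst x"]) (use that in simp)
  have XC: "X \<subseteq> carrier V \<times> carrier W" using subgroup.subset[OF X(1)] by simp
  let ?g = "\<lambda>x. (snd x, fst x \<otimes>\<^bsub>V\<^esub> inv\<^bsub>V\<^esub> s (snd x))"
  have "inj_on ?g X"
  proof (rule inj_onI)
    fix x y assume xy: "x \<in> X" "y \<in> X" "?g x = ?g y"
    have "fst x \<in> carrier V" "fst y \<in> carrier V" "s (snd x) \<in> carrier V"
      using xy XC s by auto
    with xy show "x = y" by (auto simp: prod_eq_iff V.right_cancel)
  qed
  moreover have "?g ` X \<subseteq> snd ` X \<times> ?K"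
  proof (rule image_subsetI)
    fix x assume x: "x \<in> X"
    have c: "fst x \<in> carrier V" "snd x \<in> carrier W" "s (snd x) \<in> carrier V"
      using x XC s[OF x] by auto
    have "x \<otimes>\<^bsub>V \<times>\<times> W\<^esub> inv\<^bsub>V \<times>\<times> W\<^esub> (s (snd x), snd x) \<in> X"
      using x s[OF x] X(1) by (blast intro: subgroup.m_closed subgroup.m_inv_closed)
    moreover have "x \<otimes>\<^bsub>V \<times>\<times> W\<^esub> inv\<^bsub>V \<times>\<times> W\<^esub> (s (snd x), snd x) =
        (fst x \<otimes>\<^bsub>V\<^esub> inv\<^bsub>V\<^esub> s (snd x), \<one>\<^bsub>W\<^esub>)"
      using c by (cases x) (simp add: inv_DirProd[OF V W])
    ultimately show "?g x \<in> snd ` X \<times> ?K" using x c by simp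
  qed
  moreover have "finite (snd ` X \<times> ?K)" using X(2) fin by simp
  ultimately have "card X \<le> card (snd ` X \<times> ?K)" by (rule card_inj_on_le)
  then show ?thesis by (simp add: card_cartesian_product)
qed

text \<open>By Lagrange the order is a power of \<open>p\<close>, and properness lowers the exponent
  by at least one.\<close>

lemma (in group) card_proper_subgroup_le:
  assumes "prime p" "order G = p ^ Suc n" "subgroup H G" "H \<noteq> carrier G"
  shows "card H \<le> p ^ n"
proof -
  have fin: "finite (carrier G)"
    using assms(1,2) by (metis order_gt_0_iff_finite prime_gt_0_nat zero_less_power)
  have "card H dvd p ^ Suc n" using lagrange[OF assms(3)] assms(2) by (metis dvd_triv_right)
  then obtain i where i: "i \<le> Suc n" "card H = p ^ i"
    using assms(1) divides_primepow_nat by blast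
  have "card H < p ^ Suc n"
    using psubset_card_mono[OF fin] subgroup.subset[OF assms(3)] assms(2,4)
    by (metis order_def psubsetI)
  with i have "i \<le> n" using assms(1) by (metis le_SucE less_irrefl)
  with i show ?thesis using prime_gt_0_nat[OF assms(1)] by (simp add: power_increasing Suc_leI)
qed

text \<open>
  If \<open>X\<close> projected onto \<open>W\<close> it would contain \<open>(1, e1)\<close>, \<open>(1, e2)\<close>, \<open>(1, e3)\<close> and their product;
  so the projection is proper, and by counting the kernel of the projection is all of \<open>V\<close>.
\<close>

lemma subgroup_DirProd_contains_left:
  assumes V: "group V" and W: "group W" and fin: "finite (carrier V)"
    and p: "prime p" "order W = p ^ 3"
    and X: "subgroup X (V \<times>\<times> W)" "card X = order V * p ^ 2"
    and e: "e1 \<in> carrier W" "e2 \<in> carrier W" "e3 \<in> carrier W"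
    and single: "\<And>v e. (v, e) \<in> X \<Longrightarrow> e \<in> {e1, e2, e3} \<Longrightarrow> v = \<one>\<^bsub>V\<^esub>"
    and not_in: "(\<one>\<^bsub>V\<^esub>, e1 \<otimes>\<^bsub>W\<^esub> e2 \<otimes>\<^bsub>W\<^esub> e3) \<notin> X"
    and v: "v \<in> carrier V"
  shows "(v, \<one>\<^bsub>W\<^esub>) \<in> X"
proof -
  interpret V: group V by fact
  interpret W: group W by fact
  interpret P: group "V \<times>\<times> W" by (rule DirProd_group[OF V W])
  have XC: "X \<subseteq> carrier V \<times> carrier W" using subgroup.subset[OF X(1)] by simp
  have oV: "order V > 0" using fin by (simp add: V.order_gt_0_iff_finite)
  \<comment> \<open>Infinite sets have \<open>card\<close> 0, so the positive cardinality of
    \<open>X\<close> already yields finiteness.\<close>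
  have finX: "finite X" using X(2) oV p(1) by (metis card.infinite mult_is_0 not_gr0 power_eq_0_iff not_prime_0)
  have sub: "subgroup (snd ` X) W"
  proof (rule W.subgroupI)
    show "snd ` X \<subseteq> carrier W" using XC by auto
    show "snd ` X \<noteq> {}" using subgroup.one_closed[OF X(1)] by blast
  next
    fix a assume "a \<in> snd ` X"
    then obtain x where x: "(x, a) \<in> X" by auto
    with XC have "inv\<^bsub>V \<times>\<times> W\<^esub> (x, a) = (inv\<^bsub>V\<^esub> x, inv\<^bsub>W\<^esub> a)" by (auto simp: inv_DirProd[OF V W])
    with subgroup.m_inv_closed[OF X(1) x] show "inv\<^bsub>W\<^esub> a \<in> snd ` X" by force
  next
    fix a b assume "a \<in> snd ` X" "b \<in> snd ` X"
    then obtain x y where xy: "(x, a) \<in> X" "(y, b) \<in> X" by auto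
    from subgroup.m_closed[OF X(1) xy] show "a \<otimes>\<^bsub>W\<^esub> b \<in> snd ` X" by force
  qed
  have "snd ` X \<noteq> carrier W"
  proof
    assume onto: "snd ` X = carrier W"
    have in_X: "(\<one>\<^bsub>V\<^esub>, e) \<in> X" if "e \<in> {e1, e2, e3}" for e
    proof -
      have "e \<in> snd ` X" using onto that e by auto
      then obtain x where "(x, e) \<in> X" by auto
      with single[OF this that] show ?thesis by simp
    qed
    have "(\<one>\<^bsub>V\<^esub>, e1) \<otimes>\<^bsub>V \<times>\<times> W\<^esub> (\<one>\<^bsub>V\<^esub>, e2) \<otimes>\<^bsub>V \<times>\<times> W\<^esub> (\<one>\<^bsub>V\<^esub>, e3) \<in> X"
      by (intro subgroup.m_closed[OF X(1)] in_X) auto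
    with not_in show False by simp
  qed
  with sub have le: "card (snd ` X) \<le> p ^ 2"
    using W.card_proper_subgroup_le[of p 2] p by (simp add: numeral_3_eq_3 numeral_2_eq_2)
  let ?K = "{v \<in> carrier V. (v, \<one>\<^bsub>W\<^esub>) \<in> X}"
  have "order V * p ^ 2 \<le> card (snd ` X) * card ?K"
    using card_subgroup_DirProd_le[OF V W fin X(1) finX] X(2) by simp
  also have "\<dots> \<le> p ^ 2 * card ?K" using le by simp
  finally have "order V \<le> card ?K" using p(1) by (simp add: mult.commute prime_gt_0_nat)
  then have "?K = carrier V"
    by (intro card_seteq[OF fin]) (auto simp: order_def)
  with v show ?thesis by blast
qed

section \<open>Automorphisms matching layered sets, and the layered set of a counterexample\<close>

text \<open>Only the shape of the layers matters here, so \<open>L\<close> and \<open>L'\<close> are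
  arbitrary families. Once \<open>V \<times> {\<one>}\<close> is known to be preserved,
  \<open>\<alpha>\<close> acts on each coset of it as one automorphism \<open>A\<close> of
  \<open>V\<close> followed by a translation depending on \<open>u\<close>. The singleton layers
  make the translation trivial over \<open>e1\<close>, \<open>e2\<close>, \<open>e3\<close>, hence
  over their product. Which layer \<open>u\<close> the product goes to is left open.\<close>

lemma iso_layer_of_iso_DirProd:
  assumes V: "group V" and W: "group W" and fin: "finite (carrier V)" and "I \<noteq> {}"
    and p: "prime p" "order W = p ^ 3"
    and Y: "\<And>i. i \<in> I \<Longrightarrow> subgroup (Y i) W \<and> card (Y i) = p ^ 2" "(\<Inter>i\<in>I. Y i) = {\<one>\<^bsub>W\<^esub>}"
    and e: "e1 \<in> carrier W" "e2 \<in> carrier W" "e3 \<in> carrier W"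
    and L: "\<And>u. u \<in> carrier W \<Longrightarrow> L u \<subseteq> carrier V" "\<And>u. u \<in> carrier W \<Longrightarrow> L' u \<subseteq> carrier V"
    and full: "\<And>i u. i \<in> I \<Longrightarrow> u \<in> Y i \<Longrightarrow> L u = carrier V"
    and single: "\<And>e. e \<in> {e1, e2, e3} \<Longrightarrow> L e = {\<one>\<^bsub>V\<^esub>} \<and> L' e = {\<one>\<^bsub>V\<^esub>}"
    and single': "\<And>u x. u \<in> carrier W \<Longrightarrow> L' u = {x} \<Longrightarrow> x = \<one>\<^bsub>V\<^esub>"
    and not_in: "\<one>\<^bsub>V\<^esub> \<notin> L' (e1 \<otimes>\<^bsub>W\<^esub> e2 \<otimes>\<^bsub>W\<^esub> e3)"
    and a: "\<alpha> \<in> iso (V \<times>\<times> W) (V \<times>\<times> W)"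
    and aT: "\<alpha> ` {(v, u). u \<in> carrier W \<and> v \<in> L u} = {(v, u). u \<in> carrier W \<and> v \<in> L' u}"
  obtains A u where "A \<in> iso V V" "u \<in> carrier W" "A ` L (e1 \<otimes>\<^bsub>W\<^esub> e2 \<otimes>\<^bsub>W\<^esub> e3) = L' u"
proof -
  interpret V: group V by fact
  interpret W: group W by fact
  interpret P: group "V \<times>\<times> W" by (rule DirProd_group[OF V W])
  interpret a: group_hom "V \<times>\<times> W" "V \<times>\<times> W" \<alpha>
    by unfold_locales (use a in \<open>simp add: iso_def\<close>)
  have inj: "inj_on \<alpha> (carrier V \<times> carrier W)" using a by (auto simp: iso_def bij_betw_def)
  have closed: "\<alpha> x \<in> carrier V \<times> carrier W" if "x \<in> carrier V \<times> carrier W" for x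
    using a.hom_closed[of x] that by simp
  have mem: "v \<in> L u \<longleftrightarrow> fst (\<alpha> (v, u)) \<in> L' (snd (\<alpha> (v, u)))"
    if "v \<in> carrier V" "u \<in> carrier W" for v u
  proof -
    let ?T = "{(v, u). u \<in> carrier W \<and> v \<in> L u}"
    have "?T \<subseteq> carrier V \<times> carrier W" using L(1) by blast
    then have "(v, u) \<in> ?T \<longleftrightarrow> \<alpha> (v, u) \<in> \<alpha> ` ?T"
      using inj_on_image_mem_iff[OF inj, of "(v, u)" ?T] that by simp
    then show ?thesis using that closed[of "(v, u)"] unfolding aT by (auto simp: case_prod_unfold)
  qed
  have IY: "Y i \<subseteq> carrier W" if "i \<in> I" for i using Y(1)[OF that] subgroup.subset by blast
  have im: "(v, \<one>\<^bsub>W\<^esub>) \<in> \<alpha> ` (carrier V \<times> Y i)" if "v \<in> carrier V" "i \<in> I" for v i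
  proof (rule subgroup_DirProd_contains_left[OF V W fin p _ _ e _ _ that(1)])
    have "subgroup (carrier V \<times> Y i) (V \<times>\<times> W)"
      using DirProd_subgroups[OF V V.subgroup_self W] Y(1)[OF that(2)] by blast
    then show "subgroup (\<alpha> ` (carrier V \<times> Y i)) (V \<times>\<times> W)" by (rule a.subgroup_img_is_subgroup)
    have "carrier V \<times> Y i \<subseteq> carrier V \<times> carrier W" using IY[OF that(2)] by blast
    then have "card (\<alpha> ` (carrier V \<times> Y i)) = card (carrier V \<times> Y i)"
      by (intro card_image inj_on_subset[OF inj])
    then show "card (\<alpha> ` (carrier V \<times> Y i)) = order V * p ^ 2"
      using Y(1)[OF that(2)] by (simp add: card_cartesian_product order_def)
    have sub: "\<alpha> ` (carrier V \<times> Y i) \<subseteq> {(v, u). u \<in> carrier W \<and> v \<in> L' u}"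
      unfolding aT[symmetric] using full[OF that(2)] IY[OF that(2)] by (intro image_mono) auto
    show "x = \<one>\<^bsub>V\<^esub>" if "(x, e) \<in> \<alpha> ` (carrier V \<times> Y i)" "e \<in> {e1, e2, e3}" for x e
      using subsetD[OF sub that(1)] single[OF that(2)] by simp
    show "(\<one>\<^bsub>V\<^esub>, e1 \<otimes>\<^bsub>W\<^esub> e2 \<otimes>\<^bsub>W\<^esub> e3) \<notin> \<alpha> ` (carrier V \<times> Y i)"
      using sub not_in by blast
  qed
  have sub: "carrier V \<times> {\<one>\<^bsub>W\<^esub>} \<subseteq> \<alpha> ` (carrier V \<times> {\<one>\<^bsub>W\<^esub>})"
  proof
    fix x assume "x \<in> carrier V \<times> {\<one>\<^bsub>W\<^esub>}"
    then obtain v where v: "x = (v, \<one>\<^bsub>W\<^esub>)" "v \<in> carrier V" by blast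
    from \<open>I \<noteq> {}\<close> im[OF v(2)] IY obtain y where y: "y \<in> carrier V \<times> carrier W" "x = \<alpha> y"
      unfolding v(1) by blast
    \<comment> \<open>Injectivity of \<open>\<alpha>\<close> makes the preimage of \<open>x\<close>
      the same for every \<open>i\<close>, so its second component lies in the intersection of all
      \<open>Y i\<close>.\<close>
    have "snd y \<in> Y i" if i: "i \<in> I" for i
    proof -
      obtain z where z: "z \<in> carrier V \<times> Y i" "x = \<alpha> z" using im[OF v(2) i] v(1) by blast
      then have "z \<in> carrier V \<times> carrier W" using IY[OF that] by auto
      with y z(2) have "y = z" using inj_onD[OF inj, of y z] by simp
      with z(1) show ?thesis by auto
    qed
    then have "snd y = \<one>\<^bsub>W\<^esub>" using Y(2) by blast
    with y(1) have "y \<in> carrier V \<times> {\<one>\<^bsub>W\<^esub>}" by (cases y) simp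
    with y(2) show "x \<in> \<alpha> ` (carrier V \<times> {\<one>\<^bsub>W\<^esub>})" by blast
  qed
  \<comment> \<open>The inclusion just shown says that the image covers the factor; since it cannot
    have more elements than the factor, the two coincide.\<close>
  have im_eq: "\<alpha> ` (carrier V \<times> {\<one>\<^bsub>W\<^esub>}) = carrier V \<times> {\<one>\<^bsub>W\<^esub>}"
    using card_seteq[OF _ sub] card_image_le[of "carrier V \<times> {\<one>\<^bsub>W\<^esub>}" \<alpha>] fin by simp
  have snd_one: "snd (\<alpha> (v, \<one>\<^bsub>W\<^esub>)) = \<one>\<^bsub>W\<^esub>" if "v \<in> carrier V" for v
  proof -
    have "\<alpha> (v, \<one>\<^bsub>W\<^esub>) \<in> \<alpha> ` (carrier V \<times> {\<one>\<^bsub>W\<^esub>})" using that by blast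
    then show ?thesis unfolding im_eq by auto
  qed
  define A where "A v = fst (\<alpha> (v, \<one>\<^bsub>W\<^esub>))" for v
  have A: "A \<in> iso V V" unfolding A_def using iso_fst_DirProd[OF V W fin a snd_one] .
  have A_bij: "bij_betw A (carrier V) (carrier V)" using A by (simp add: iso_def)
  have A_im: "A ` carrier V = carrier V" using A_bij by (simp add: bij_betw_def)
  have A_one: "A \<one>\<^bsub>V\<^esub> = \<one>\<^bsub>V\<^esub>" using A hom_one[OF _ V V] by (simp add: iso_def)
  have A_closed: "A v \<in> carrier V" if "v \<in> carrier V" for v using A_bij bij_betwE that by blast
  \<comment> \<open>Factor \<open>(v, u)\<close> as \<open>(v, \<one>)\<close> times
    \<open>(\<one>, u)\<close>: the first contributes \<open>A v\<close>, the second the translation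
    part and the target layer.\<close>
  have coset: "\<alpha> (v, u) = (A v \<otimes>\<^bsub>V\<^esub> fst (\<alpha> (\<one>\<^bsub>V\<^esub>, u)), snd (\<alpha> (\<one>\<^bsub>V\<^esub>, u)))"
    if "v \<in> carrier V" "u \<in> carrier W" for v u
  proof -
    have "\<alpha> (v, u) = \<alpha> (v, \<one>\<^bsub>W\<^esub>) \<otimes>\<^bsub>V \<times>\<times> W\<^esub> \<alpha> (\<one>\<^bsub>V\<^esub>, u)"
      using a.hom_mult[of "(v, \<one>\<^bsub>W\<^esub>)" "(\<one>\<^bsub>V\<^esub>, u)"] that by simp
    moreover have "snd (\<alpha> (\<one>\<^bsub>V\<^esub>, u)) \<in> carrier W" using closed[of "(\<one>\<^bsub>V\<^esub>, u)"] that by auto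
    ultimately show ?thesis using snd_one[OF that(1)]
      by (simp add: mult_DirProd' A_def)
  qed
  \<comment> \<open>A layer that receives a singleton is a singleton: any \<open>y\<close> in it
    comes from some \<open>v\<close> in \<open>L e\<close>, so \<open>v\<close> is the identity and
    \<open>y\<close> equals \<open>x\<close>. By \<open>single'\<close> the only element of such a
    layer is the identity.\<close>
  have fix_one: "fst (\<alpha> (\<one>\<^bsub>V\<^esub>, e)) = \<one>\<^bsub>V\<^esub>" if e': "e \<in> {e1, e2, e3}" for e
  proof -
    have ec: "e \<in> carrier W" using that e by auto
    obtain x u where xu: "\<alpha> (\<one>\<^bsub>V\<^esub>, e) = (x, u)" by fastforce
    have c: "x \<in> carrier V" "u \<in> carrier W" using closed[of "(\<one>\<^bsub>V\<^esub>, e)"] ec xu by auto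
    have "x \<in> L' u" using mem[of "\<one>\<^bsub>V\<^esub>" e] single[OF that] ec xu by simp
    moreover have "y = x" if y: "y \<in> L' u" for y
    proof -
      have yc: "y \<in> carrier V" using y L(2) c by blast
      with c obtain v where v: "v \<in> carrier V" "y \<otimes>\<^bsub>V\<^esub> inv\<^bsub>V\<^esub> x = A v"
        using A_im V.m_closed V.inv_closed by (metis imageE)
      have y_eq: "y = A v \<otimes>\<^bsub>V\<^esub> x" using v yc c by (simp flip: v(2) add: V.m_assoc)
      then have "v \<in> L e" using mem[OF v(1) ec] coset[OF v(1) ec] xu y by simp
      then have "v = \<one>\<^bsub>V\<^esub>" using single[OF e'] by simp
      with y_eq c show "y = x" by (simp add: A_one)
    qed
    ultimately have "L' u = {x}" by blast
    with single' c xu show ?thesis by simp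
  qed
  let ?w = "e1 \<otimes>\<^bsub>W\<^esub> e2 \<otimes>\<^bsub>W\<^esub> e3"
  have wc: "?w \<in> carrier W" using e by simp
  have "\<alpha> (\<one>\<^bsub>V\<^esub>, ?w) = \<alpha> (\<one>\<^bsub>V\<^esub>, e1) \<otimes>\<^bsub>V \<times>\<times> W\<^esub> \<alpha> (\<one>\<^bsub>V\<^esub>, e2) \<otimes>\<^bsub>V \<times>\<times> W\<^esub> \<alpha> (\<one>\<^bsub>V\<^esub>, e3)"
    using a.hom_mult[of "(\<one>\<^bsub>V\<^esub>, e1 \<otimes>\<^bsub>W\<^esub> e2)" "(\<one>\<^bsub>V\<^esub>, e3)"] a.hom_mult[of "(\<one>\<^bsub>V\<^esub>, e1)" "(\<one>\<^bsub>V\<^esub>, e2)"] e by simp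
  then have "fst (\<alpha> (\<one>\<^bsub>V\<^esub>, ?w)) = \<one>\<^bsub>V\<^esub>"
    using fix_one[of e1] fix_one[of e2] fix_one[of e3] by (simp add: mult_DirProd')
  then have Lw: "v \<in> L ?w \<longleftrightarrow> A v \<in> L' (snd (\<alpha> (\<one>\<^bsub>V\<^esub>, ?w)))" if "v \<in> carrier V" for v
    using mem[OF that wc] coset[OF that wc] A_closed[OF that] by simp
  have uc: "snd (\<alpha> (\<one>\<^bsub>V\<^esub>, ?w)) \<in> carrier W" using closed[of "(\<one>\<^bsub>V\<^esub>, ?w)"] wc by auto
  have "A ` L ?w = L' (snd (\<alpha> (\<one>\<^bsub>V\<^esub>, ?w)))"
  proof
    show "A ` L ?w \<subseteq> L' (snd (\<alpha> (\<one>\<^bsub>V\<^esub>, ?w)))" using Lw L(1)[OF wc] by blast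
    show "L' (snd (\<alpha> (\<one>\<^bsub>V\<^esub>, ?w))) \<subseteq> A ` L ?w"
    proof
      fix y assume y: "y \<in> L' (snd (\<alpha> (\<one>\<^bsub>V\<^esub>, ?w)))"
      with L(2)[OF uc] A_im obtain v where "v \<in> carrier V" "y = A v" by blast
      with Lw y show "y \<in> A ` L ?w" by blast
    qed
  qed
  from that[OF A uc this] show thesis .
qed

text \<open>
  In the application \<open>e1\<close>, \<open>e2\<close>, \<open>e3\<close> are the vectors obtained from \<open>w = (1, 1, 1)\<close> by changing one sign
  and the \<open>Y i\<close> are the coordinate planes.
\<close>

lemma DCI_group_of_CI_group_DirProd:
  assumes V: "comm_group V" and W: "group W" and fin: "finite (carrier V)" and "I \<noteq> {}"
    and p: "prime p" "order W = p ^ 3"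
    and Y: "\<And>i. i \<in> I \<Longrightarrow> subgroup (Y i) W \<and> card (Y i) = p ^ 2" "(\<Inter>i\<in>I. Y i) = {\<one>\<^bsub>W\<^esub>}"
    and e: "e1 \<in> carrier W" "e2 \<in> carrier W" "e3 \<in> carrier W"
    and w: "w = e1 \<otimes>\<^bsub>W\<^esub> e2 \<otimes>\<^bsub>W\<^esub> e3" "w \<noteq> inv\<^bsub>W\<^esub> w"
      "w \<notin> {e1, e2, e3, inv\<^bsub>W\<^esub> e1, inv\<^bsub>W\<^esub> e2, inv\<^bsub>W\<^esub> e3}"
    and not_in_Y: "\<And>i. i \<in> I \<Longrightarrow> Y i \<inter> {e1, e2, e3, w} = {}"
    and CI: "CI_group (V \<times>\<times> W)"
  shows "DCI_group V"
proof (rule ccontr)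
  interpret V: comm_group V by fact
  interpret W: group W by fact
  interpret P: group "V \<times>\<times> W" by (rule DirProd_group[OF V.group_axioms W])
  assume "\<not> DCI_group V"
  then obtain S S' f where S: "S \<subseteq> carrier V" "S' \<subseteq> carrier V" and f: "cayley_iso V S S' f"
    and one: "\<one>\<^bsub>V\<^esub> \<notin> S" "\<one>\<^bsub>V\<^esub> \<notin> S'" and two: "2 \<le> card S"
    and no: "\<not> (\<exists>\<alpha>\<in>iso V V. \<alpha> ` S = S')"
    using V.DCI_counterexample_large[OF fin] by metis
  have card_eq: "card S = card S'" by (rule V.cayley_iso_card[OF f S])
  have wc: "w \<in> carrier W" using w(1) e by simp
  define E where "E = {e1, e2, e3, inv\<^bsub>W\<^esub> e1, inv\<^bsub>W\<^esub> e2, inv\<^bsub>W\<^esub> e3}"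
  define U where "U = (\<Union>i\<in>I. Y i)"
  \<comment> \<open>The four conditions exclude one another: \<open>w\<close> and its inverse differ
    and avoid both \<open>E\<close> and \<open>U\<close>, and \<open>E\<close> avoids
    \<open>U\<close>. So the order of the tests does not affect the layers.\<close>
  define L where "L R u = (if u \<in> U then carrier V else if u \<in> E then {\<one>\<^bsub>V\<^esub>}
    else if u = w then R else if u = inv\<^bsub>W\<^esub> w then (\<lambda>x. inv\<^bsub>V\<^esub> x) ` R else {})" for R u
  have E_sub: "E \<subseteq> carrier W" using e by (auto simp: E_def)
  have E_inv: "inv\<^bsub>W\<^esub> u \<in> E" if "u \<in> E" for u using that e by (auto simp: E_def)
  have U_sub: "U \<subseteq> carrier W" using Y(1) subgroup.subset unfolding U_def by blast
  have U_inv: "inv\<^bsub>W\<^esub> u \<in> U" if "u \<in> U" for u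
  proof -
    from that obtain i where i: "i \<in> I" "u \<in> Y i" unfolding U_def by blast
    then have "subgroup (Y i) W" using Y(1) by simp
    from subgroup.m_inv_closed[OF this i(2)] i(1) show ?thesis unfolding U_def by blast
  qed
  have inv_iff: "inv\<^bsub>W\<^esub> u \<in> E \<longleftrightarrow> u \<in> E" "inv\<^bsub>W\<^esub> u \<in> U \<longleftrightarrow> u \<in> U" if "u \<in> carrier W" for u
    using E_inv[of u] E_inv[of "inv\<^bsub>W\<^esub> u"] U_inv[of u] U_inv[of "inv\<^bsub>W\<^esub> u"] W.inv_inv[OF that]
    by auto
  have wE: "w \<notin> E" using w(3) by (simp add: E_def)
  have notU: "e1 \<notin> U" "e2 \<notin> U" "e3 \<notin> U" "w \<notin> U" using not_in_Y unfolding U_def by blast+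
  have iw: "inv\<^bsub>W\<^esub> w \<notin> E" "inv\<^bsub>W\<^esub> w \<notin> U" using wE notU(4) inv_iff[OF wc] by auto
  have L_sub: "L R u \<subseteq> carrier V" if "R \<subseteq> carrier V" for R u
    using that by (auto simp: L_def)
  have L_cases: "L R u = carrier V \<or> L R u = {\<one>\<^bsub>V\<^esub>} \<or> L R u = R \<or> L R u = (\<lambda>x. inv\<^bsub>V\<^esub> x) ` R \<or> L R u = {}"
    for R u by (simp add: L_def)
  have L_inv: "inv\<^bsub>V\<^esub> v \<in> L R (inv\<^bsub>W\<^esub> u)" if R: "R \<subseteq> carrier V" and v: "v \<in> L R u" and u: "u \<in> carrier W" for R v u
  proof -
    consider "u \<in> U" | "u \<notin> U" "u \<in> E" | "u = w" | "u = inv\<^bsub>W\<^esub> w"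
      using v by (auto simp: L_def split: if_splits)
    then show ?thesis
    proof cases
      case 1
      then show ?thesis using v R L_sub U_inv by (auto simp: L_def)
    next
      case 2
      then show ?thesis using v u inv_iff by (simp add: L_def)
    next
      case 3
      then show ?thesis using v wE notU(4) iw w(2) by (simp add: L_def)
    next
      case 4
      then have "v \<in> (\<lambda>x. inv\<^bsub>V\<^esub> x) ` R" using v iw w(2) by (simp add: L_def)
      then show ?thesis using 4 R wc wE notU(4) by (auto simp: L_def)
    qed
  qed
  let ?T = "\<lambda>R. {(v, u). u \<in> carrier W \<and> v \<in> L R u}"
  have sym: "symmetric_subset (V \<times>\<times> W) (?T R)" if R: "R \<subseteq> carrier V" for R
    unfolding P.symmetric_subset_iff
  proof (intro conjI ballI)
    show "?T R \<subseteq> carrier (V \<times>\<times> W)" using L_sub[OF R] by auto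
    fix x assume x: "x \<in> ?T R"
    obtain v u where vu: "x = (v, u)" by fastforce
    with x have m: "u \<in> carrier W" "v \<in> L R u" by auto
    then have "v \<in> carrier V" using L_sub[OF R] by blast
    with m show "inv\<^bsub>V \<times>\<times> W\<^esub> x \<in> ?T R"
      using L_inv[OF R m(2,1)] by (simp add: vu inv_DirProd[OF V.group_axioms W])
  qed
  \<comment> \<open>Passing to inverses reverses all arcs, and a bijection that preserves arcs
    preserves reversed arcs as well. Hence the same \<open>f\<close> serves the layer over the
    inverse of \<open>w\<close>.\<close>
  have f_inv: "cayley_iso V ((\<lambda>x. inv\<^bsub>V\<^esub> x) ` S) ((\<lambda>x. inv\<^bsub>V\<^esub> x) ` S') f"
  proof -
    have "h \<otimes>\<^bsub>V\<^esub> inv\<^bsub>V\<^esub> g \<in> (\<lambda>x. inv\<^bsub>V\<^esub> x) ` R \<longleftrightarrow> g \<otimes>\<^bsub>V\<^esub> inv\<^bsub>V\<^esub> h \<in> R"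
      if R: "R \<subseteq> carrier V" and gh: "g \<in> carrier V" "h \<in> carrier V" for R g h
    proof -
      have *: "h \<otimes>\<^bsub>V\<^esub> inv\<^bsub>V\<^esub> g = inv\<^bsub>V\<^esub> (g \<otimes>\<^bsub>V\<^esub> inv\<^bsub>V\<^esub> h)"
        using gh by (simp add: V.inv_mult_group)
      have "x = g \<otimes>\<^bsub>V\<^esub> inv\<^bsub>V\<^esub> h" if "x \<in> R" "inv\<^bsub>V\<^esub> (g \<otimes>\<^bsub>V\<^esub> inv\<^bsub>V\<^esub> h) = inv\<^bsub>V\<^esub> x" for x
      proof -
        have "x \<in> carrier V" "g \<otimes>\<^bsub>V\<^esub> inv\<^bsub>V\<^esub> h \<in> carrier V" using that(1) R gh by auto
        with that(2) show ?thesis by (metis V.inv_inv)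
      qed
      then show ?thesis unfolding * by blast
    qed
    note * = this
    show ?thesis
      unfolding cayley_iso_def
      using cayley_isoD[OF f] by (simp add: *[OF S(1)] *[OF S(2)])
  qed
  have f1: "cayley_iso V {\<one>\<^bsub>V\<^esub>} {\<one>\<^bsub>V\<^esub>} f"
    using V.cayley_iso_insert_one(1)[of "{}" "{}" f] cayley_isoD(1)[OF f] by (simp add: cayley_iso_def)
  have "cayley_iso (V \<times>\<times> W) (?T S) (?T S') (map_prod f id)"
  proof (rule cayley_iso_DirProd[OF V.group_axioms W cayley_isoD(1)[OF f]])
    fix u
    have "cayley_iso V (carrier V) (carrier V) f" "cayley_iso V {} {} f"
      using cayley_isoD(1)[OF f] cayley_isoD(3)[OF f] by (auto simp: cayley_iso_def)
    with f f_inv f1 show "cayley_iso V (L S u) (L S' u) f" by (simp add: L_def)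
  qed
  then obtain \<alpha> where a: "\<alpha> \<in> iso (V \<times>\<times> W) (V \<times>\<times> W)" "\<alpha> ` ?T S = ?T S'"
    using CI[unfolded CI_group_iff_cayley_iso[OF P.group_axioms], rule_format,
        OF sym[OF S(1)] sym[OF S(2)]] by blast
  have card_inv: "card ((\<lambda>x. inv\<^bsub>V\<^esub> x) ` R) = card R" if "R \<subseteq> carrier V" for R
    using V.iso_m_inv that by (intro card_image) (auto simp: iso_def bij_betw_def intro: inj_on_subset)
  \<comment> \<open>Together with \<open>two\<close> this puts the size of \<open>S\<close>, and so
    that of \<open>S'\<close> and of its inverse set, strictly between 1 and the order of
    \<open>V\<close>. Cardinality then separates these layers from the full, singleton and empty
    ones.\<close>
  have "S \<noteq> carrier V" using one by auto
  then have less: "card S < order V" using S(1) psubset_card_mono[OF fin] by (simp add: order_def psubsetI)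
  obtain A u where A: "A \<in> iso V V" "u \<in> carrier W" "A ` L S (e1 \<otimes>\<^bsub>W\<^esub> e2 \<otimes>\<^bsub>W\<^esub> e3) = L S' u"
  proof (rule iso_layer_of_iso_DirProd[OF V.group_axioms W fin \<open>I \<noteq> {}\<close> p Y e _ _ _ _ _ _ a])
    show "L S u \<subseteq> carrier V" "L S' u \<subseteq> carrier V" for u using L_sub S by auto
    show "L S u = carrier V" if "i \<in> I" "u \<in> Y i" for i u
      using that by (auto simp: L_def U_def)
    show "L S x = {\<one>\<^bsub>V\<^esub>} \<and> L S' x = {\<one>\<^bsub>V\<^esub>}" if "x \<in> {e1, e2, e3}" for x
      using that notU by (auto simp: L_def E_def)
    show "\<one>\<^bsub>V\<^esub> \<notin> L S' (e1 \<otimes>\<^bsub>W\<^esub> e2 \<otimes>\<^bsub>W\<^esub> e3)"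
      using one wE notU(4) by (simp add: L_def flip: w(1))
    show "x = \<one>\<^bsub>V\<^esub>" if "L S' u = {x}" for u x
    proof -
      have c: "card (L S' u) = 1" using that by simp
      consider "L S' u = carrier V" | "L S' u = {\<one>\<^bsub>V\<^esub>}" | "L S' u = S'" | "L S' u = (\<lambda>x. inv\<^bsub>V\<^esub> x) ` S'" | "L S' u = {}"
        using L_cases[of S' u] by blast
      then show ?thesis
        using that c two less card_eq card_inv[OF S(2)] by cases (auto simp: order_def)
    qed
  qed blast
  have A_card: "card (A ` S) = card S"
    using A(1) S(1) by (intro card_image) (auto simp: iso_def bij_betw_def intro: inj_on_subset)
  have AS: "A ` S = L S' u" using A(3)[folded w(1)] wE notU(4) by (simp add: L_def)
  consider "L S' u = carrier V" | "L S' u = {\<one>\<^bsub>V\<^esub>}" | "L S' u = S'" | "L S' u = (\<lambda>x. inv\<^bsub>V\<^esub> x) ` S'" | "L S' u = {}"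
    using L_cases[of S' u] by blast
  then show False
  proof cases
    \<comment> \<open>The automorphism may exchange the roles of \<open>w\<close> and its inverse.
      As \<open>V\<close> is commutative, composing with inversion repairs this. Case 3 contradicts
      \<open>no\<close> directly; the other cases fail by cardinality.\<close>
    case 4
    have "(\<lambda>x. inv\<^bsub>V\<^esub> x) \<circ> A \<in> iso V V" by (rule iso_set_trans[OF A(1) V.iso_m_inv])
    moreover have "((\<lambda>x. inv\<^bsub>V\<^esub> x) \<circ> A) ` S = (\<lambda>x. x) ` S'"
      unfolding image_comp[symmetric] AS 4 image_image
      by (rule image_cong) (use S(2) in auto)
    ultimately show False using no by auto
  qed (use AS A_card two less no A(1) in \<open>auto simp: order_def\<close>)
qed

section \<open>The groups \<open>Zp_power\<close> in coordinates\<close>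

lemma carrier_Zp_power: "p > 0 \<Longrightarrow> carrier (Zp_power p r) = {..<r} \<rightarrow>\<^sub>E {0..<int p}"
  by (simp add: Zp_power_def carrier_integer_mod_group)

lemma mult_Zp_power: "x \<otimes>\<^bsub>Zp_power p r\<^esub> y = (\<lambda>i\<in>{..<r}. (x i + y i) mod int p)"
  by (simp add: Zp_power_def)

lemma one_Zp_power: "\<one>\<^bsub>Zp_power p r\<^esub> = (\<lambda>i\<in>{..<r}. 0)"
  by (simp add: Zp_power_def)

lemma inv_Zp_power:
  assumes "x \<in> carrier (Zp_power p r)"
  shows "inv\<^bsub>Zp_power p r\<^esub> x = (\<lambda>i\<in>{..<r}. (- x i) mod int p)"
proof -
  have x: "x \<in> (\<Pi>\<^sub>E i\<in>{..<r}. carrier (integer_mod_group p))" using assms by (simp add: Zp_power_def)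
  then have "inv\<^bsub>Zp_power p r\<^esub> x = (\<lambda>i\<in>{..<r}. inv\<^bsub>integer_mod_group p\<^esub> x i)"
    unfolding Zp_power_def by (rule inv_product_group) simp
  also have "\<dots> = (\<lambda>i\<in>{..<r}. (- x i) mod int p)"
    by (rule restrict_ext) (use PiE_mem[OF x] in simp)
  finally show ?thesis .
qed

lemma comm_group_Zp_power: "comm_group (Zp_power p r)"
proof -
  interpret group "Zp_power p r" by (rule group_Zp_power)
  show ?thesis
    by (rule group_comm_groupI) (simp add: mult_Zp_power add.commute)
qed

lemma order_Zp_power: "p > 0 \<Longrightarrow> order (Zp_power p r) = p ^ r"
  by (simp add: order_def carrier_Zp_power card_PiE)

text \<open>Tuples are cut at position \<open>m\<close> and glued again. Elements of the carriers
  are \<open>undefined\<close> outside their index sets, which is why every map is written as a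
  restriction.\<close>

lemma Zp_power_add_iso:
  assumes "p > 0"
  shows "Zp_power p (m + n) \<cong> Zp_power p m \<times>\<times> Zp_power p n"
proof -
  let ?f = "\<lambda>x :: nat \<Rightarrow> int. (\<lambda>i\<in>{..<m}. x i, \<lambda>i\<in>{..<n}. x (i + m))"
  let ?g = "\<lambda>(a :: nat \<Rightarrow> int, b). \<lambda>i\<in>{..<m + n}. if i < m then a i else b (i - m)"
  have C: "carrier (Zp_power p m \<times>\<times> Zp_power p n) = ({..<m} \<rightarrow>\<^sub>E {0..<int p}) \<times> ({..<n} \<rightarrow>\<^sub>E {0..<int p})"
    using assms by (simp add: carrier_Zp_power)
  have f_closed: "?f x \<in> carrier (Zp_power p m \<times>\<times> Zp_power p n)" if "x \<in> carrier (Zp_power p (m + n))" for x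
    using that assms unfolding C carrier_Zp_power[OF assms] by (auto simp: PiE_iff)
  have g_closed: "?g y \<in> carrier (Zp_power p (m + n))" if "y \<in> carrier (Zp_power p m \<times>\<times> Zp_power p n)" for y
    using that unfolding C carrier_Zp_power[OF assms] by (auto simp: PiE_iff)
  have "?f \<in> hom (Zp_power p (m + n)) (Zp_power p m \<times>\<times> Zp_power p n)"
    using f_closed by (auto intro!: homI simp: mult_Zp_power fun_eq_iff)
  moreover have "bij_betw ?f (carrier (Zp_power p (m + n))) (carrier (Zp_power p m \<times>\<times> Zp_power p n))"
  proof (rule bij_betw_byWitness[where f' = ?g])
    show "\<forall>x\<in>carrier (Zp_power p (m + n)). ?g (?f x) = x"
    proof
      fix x assume x: "x \<in> carrier (Zp_power p (m + n))"
      have "?g (?f x) i = x i" for i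
      proof (cases "i < m + n")
        case True
        then have "i < m \<or> i - m < n" by linarith
        with True show ?thesis by auto
      next
        case False
        then have "x i = undefined"
          using PiE_arb[of x "{..<m + n}"] x carrier_Zp_power[OF assms] by auto
        with False show ?thesis by simp
      qed
      then show "?g (?f x) = x" by (rule ext)
    qed
    show "\<forall>y\<in>carrier (Zp_power p m \<times>\<times> Zp_power p n). ?f (?g y) = y"
    proof
      fix y assume y: "y \<in> carrier (Zp_power p m \<times>\<times> Zp_power p n)"
      obtain a b where ab: "y = (a, b)" by fastforce
      have "restrict (?g y) {..<m} = restrict a {..<m}" "(\<lambda>i\<in>{..<n}. ?g y (i + m)) = restrict b {..<n}"
        unfolding ab by (simp_all add: restrict_def fun_eq_iff)
      moreover have "restrict a {..<m} = a" "restrict b {..<n} = b"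
        using y unfolding C ab by (auto intro: PiE_restrict)
      ultimately show "?f (?g y) = y" by (simp only: ab)
    qed
  qed (use f_closed g_closed in blast)+
  ultimately show ?thesis unfolding is_iso_def iso_def by blast
qed

lemma subgroup_coordinate_hyperplane:
  assumes "j < r"
  shows "subgroup {x \<in> carrier (Zp_power p r). x j = 0} (Zp_power p r)"
proof -
  interpret group "Zp_power p r" by (rule group_Zp_power)
  have "inv\<^bsub>Zp_power p r\<^esub> x \<in> {x \<in> carrier (Zp_power p r). x j = 0}"
    if "x \<in> {x \<in> carrier (Zp_power p r). x j = 0}" for x
    using that \<open>j < r\<close> inv_closed[of x] by (simp add: inv_Zp_power)
  moreover have "x \<otimes>\<^bsub>Zp_power p r\<^esub> y \<in> {x \<in> carrier (Zp_power p r). x j = 0}"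
    if "x \<in> {x \<in> carrier (Zp_power p r). x j = 0}" "y \<in> {x \<in> carrier (Zp_power p r). x j = 0}" for x y
    using that \<open>j < r\<close> m_closed[of x y] by (simp add: mult_Zp_power)
  moreover have "\<one>\<^bsub>Zp_power p r\<^esub> \<in> {x \<in> carrier (Zp_power p r). x j = 0}"
    using \<open>j < r\<close> one_closed by (simp add: one_Zp_power)
  ultimately show ?thesis by (intro subgroupI) blast+
qed

text \<open>The hyperplane is itself a product of coordinate sets, with factor \<open>{0}\<close> at
  position \<open>j\<close>; that position contributes 1 to the count and each of the remaining
  \<open>r\<close> contributes \<open>p\<close>.\<close>

lemma card_coordinate_hyperplane:
  assumes "p > 0" "j < Suc r"
  shows "card {x \<in> carrier (Zp_power p (Suc r)). x j = 0} = p ^ r"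
proof -
  have "{x \<in> carrier (Zp_power p (Suc r)). x j = 0} =
      (\<Pi>\<^sub>E i\<in>{..<Suc r}. if i = j then {0} else {0..<int p})"
    (is "?H = ?P")
  proof
    show "?H \<subseteq> ?P"
    proof
      fix x assume "x \<in> ?H"
      then have x: "x \<in> {..<Suc r} \<rightarrow>\<^sub>E {0..<int p}" "x j = 0" using carrier_Zp_power[OF assms(1)] by auto
      show "x \<in> ?P"
        by (rule PiE_I) (use PiE_mem[OF x(1)] x(2) PiE_arb[OF x(1)] in simp_all)
    qed
    have "?P \<subseteq> carrier (Zp_power p (Suc r))"
      using assms by (simp add: carrier_Zp_power) (rule PiE_mono, simp)
    moreover have "x j = 0" if "x \<in> ?P" for x
      using PiE_mem[OF that, of j] assms(2) by simp
    ultimately show "?P \<subseteq> ?H" by blast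
  qed
  then have "card {x \<in> carrier (Zp_power p (Suc r)). x j = 0} =
      (\<Prod>i\<in>{..<Suc r}. if i = j then 1 else p)"
    by (simp add: card_PiE if_distrib cong: if_cong)
  also have "\<dots> = (\<Prod>i\<in>{..<Suc r} - {j}. p)"
    by (rule prod.mono_neutral_cong_right) auto
  finally show ?thesis using assms(2) by simp
qed

section \<open>Sign vectors for odd \<open>p\<close>, the case \<open>p = 2\<close>, and the
  conclusion\<close>

lemma DCI_group_of_CI_group_DirProd_Zp_power_3:
  assumes V: "comm_group V" and fin: "finite (carrier V)" and p: "prime p" "p \<noteq> 2"
    and CI: "CI_group (V \<times>\<times> Zp_power p 3)"
  shows "DCI_group V"
proof -
  have p3: "3 \<le> p" using prime_ge_2_nat[OF p(1)] p(2) by simp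
  then have pos: "p > 0" by simp
  interpret W: group "Zp_power p 3" by (rule group_Zp_power)
  define Y where "Y j = {x \<in> carrier (Zp_power p 3). x j = 0}" for j
  define e where "e j = (\<lambda>i\<in>{..<3::nat}. if i = j then int p - 1 else 1)" for j :: nat
  define w where "w = (\<lambda>i\<in>{..<3::nat}. 1 :: int)"
  have less3: "i < 3 \<longleftrightarrow> i = 0 \<or> i = 1 \<or> i = 2" for i :: nat by auto
  have ec: "e j \<in> carrier (Zp_power p 3)" for j
    using p3 by (simp add: e_def carrier_Zp_power[OF pos] PiE_iff)
  have wc: "w \<in> carrier (Zp_power p 3)"
    using p3 by (simp add: w_def carrier_Zp_power[OF pos] PiE_iff)
  have inv_e: "(inv\<^bsub>Zp_power p 3\<^esub> e j) i = int p - 1" if "i < 3" "i \<noteq> j" for i j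
    unfolding inv_Zp_power[OF ec] using that p3 by (simp add: e_def zmod_minus1)
  have inv_w: "(inv\<^bsub>Zp_power p 3\<^esub> w) i = int p - 1" if "i < 3" for i
    unfolding inv_Zp_power[OF wc] using that p3 by (simp add: w_def zmod_minus1)
  \<comment> \<open>Oddness of \<open>p\<close> enters here: \<open>int p - 1\<close> represents -1,
    which has to differ from 1 as well as from 0.\<close>
  have neq: "int p - 1 \<noteq> 1" "int p - 1 \<noteq> 0" using p3 by auto
  show ?thesis
  proof (rule DCI_group_of_CI_group_DirProd[OF V W.group_axioms fin, of "{..<3}" p Y "e 0" "e 1" "e 2" w])
    show "{..<3::nat} \<noteq> {}" by (simp add: lessThan_empty_iff)
    show "order (Zp_power p 3) = p ^ 3" by (rule order_Zp_power[OF pos])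
    show "subgroup (Y i) (Zp_power p 3) \<and> card (Y i) = p ^ 2" if "i \<in> {..<3}" for i
      using subgroup_coordinate_hyperplane[of i 3 p] card_coordinate_hyperplane[of p i 2] that pos
      by (simp add: Y_def numeral_3_eq_3 numeral_2_eq_2)
    show "(\<Inter>i\<in>{..<3}. Y i) = {\<one>\<^bsub>Zp_power p 3\<^esub>}"
    proof
      show "{\<one>\<^bsub>Zp_power p 3\<^esub>} \<subseteq> (\<Inter>i\<in>{..<3}. Y i)"
        using W.one_closed by (auto simp: Y_def) (simp add: one_Zp_power)
      show "(\<Inter>i\<in>{..<3}. Y i) \<subseteq> {\<one>\<^bsub>Zp_power p 3\<^esub>}"
      proof
        fix x assume x: "x \<in> (\<Inter>i\<in>{..<3}. Y i)"
        then have "x \<in> Y 0" by auto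
        then have "x \<in> {..<3} \<rightarrow>\<^sub>E {0..<int p}" by (simp add: Y_def carrier_Zp_power[OF pos])
        then have "x = restrict x {..<3}" by (rule PiE_restrict[symmetric])
        also have "\<dots> = (\<lambda>i\<in>{..<3}. 0)" using x by (intro restrict_ext) (simp add: Y_def)
        finally show "x \<in> {\<one>\<^bsub>Zp_power p 3\<^esub>}" by (simp add: one_Zp_power)
      qed
    qed
    \<comment> \<open>Each coordinate of the sum is 1 + 1 - 1, but reduced after every addition. At
      coordinate 2 the partial sum is 2 and -1 comes last; at coordinates 0 and 1 the partial sum is
      already 0 and 1 is added.\<close>
    have "(2 mod int p + (int p - 1)) mod int p = 1" "1 mod int p = 1"
      using p3 by (simp_all add: mod_add_left_eq)
    then show "w = e 0 \<otimes>\<^bsub>Zp_power p 3\<^esub> e 1 \<otimes>\<^bsub>Zp_power p 3\<^esub> e 2"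
      by (auto simp: fun_eq_iff mult_Zp_power w_def e_def less3)
    have "w 0 \<noteq> (inv\<^bsub>Zp_power p 3\<^esub> w) 0" using neq by (simp add: inv_w) (simp add: w_def)
    then show "w \<noteq> inv\<^bsub>Zp_power p 3\<^esub> w" by metis
    have "w \<noteq> e j" if "j < 3" for j
    proof -
      have "w j \<noteq> e j j" using that neq by (simp add: w_def e_def)
      then show ?thesis by metis
    qed
    moreover have "w \<noteq> inv\<^bsub>Zp_power p 3\<^esub> (e j)" if "i < 3" "i \<noteq> j" for i j
    proof -
      have "w i \<noteq> (inv\<^bsub>Zp_power p 3\<^esub> e j) i" using that neq by (simp add: inv_e) (simp add: w_def)
      then show ?thesis by metis
    qed
    \<comment> \<open>The first index is a coordinate at which the inverse of the vector has entry
      -1 while \<open>w\<close> has 1; any coordinate other than the one with the changed sign will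
      do.\<close>
    from this[of 1 0] this[of 0 1] this[of 0 2]
    have "w \<noteq> inv\<^bsub>Zp_power p 3\<^esub> (e 0)" "w \<noteq> inv\<^bsub>Zp_power p 3\<^esub> (e 1)" "w \<noteq> inv\<^bsub>Zp_power p 3\<^esub> (e 2)"
      by simp_all
    ultimately show "w \<notin> {e 0, e 1, e 2, inv\<^bsub>Zp_power p 3\<^esub> e 0, inv\<^bsub>Zp_power p 3\<^esub> e 1, inv\<^bsub>Zp_power p 3\<^esub> e 2}"
      by simp
    show "Y i \<inter> {e 0, e 1, e 2, w} = {}" if "i \<in> {..<3}" for i
    proof -
      have "e j i \<noteq> 0" "w i \<noteq> 0" for j using that neq by (simp_all add: e_def w_def)
      then show ?thesis by (auto simp: Y_def)
    qed
  qed (use p ec CI in auto)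
qed

text \<open>Entries are 0 or 1 and \<open>(- 1) mod 2 = 1\<close>, so every element is its own
  inverse.\<close>

lemma symmetric_subset_Zp_power_2:
  assumes "S \<subseteq> carrier (Zp_power 2 r)"
  shows "symmetric_subset (Zp_power 2 r) S"
proof -
  interpret group "Zp_power 2 r" by (rule group_Zp_power)
  have "inv\<^bsub>Zp_power 2 r\<^esub> x = x" if "x \<in> carrier (Zp_power 2 r)" for x
  proof -
    have "x i \<in> {0, 1}" if "i < r" for i
      using PiE_mem[of x "{..<r}" "\<lambda>_. {0..<2}" i] that \<open>x \<in> _\<close> by (force simp: carrier_Zp_power)
    moreover have "x i = undefined" if "\<not> i < r" for i
      using PiE_arb[of x "{..<r}" "\<lambda>_. {0..<2}" i] that \<open>x \<in> _\<close> by (simp add: carrier_Zp_power)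
    ultimately show ?thesis using that by (force simp: inv_Zp_power fun_eq_iff)
  qed
  then show ?thesis using assms by (auto simp: symmetric_subset_iff subset_iff)
qed

lemma DCI_group_Zp_power_2:
  assumes "CI_group (Zp_power 2 r)"
  shows "DCI_group (Zp_power 2 r)"
  using assms symmetric_subset_Zp_power_2
  unfolding DCI_group_iff_cayley_iso[OF group_Zp_power] CI_group_iff_cayley_iso[OF group_Zp_power]
  by blast

theorem theorem1p1:
  fixes p r :: nat
  assumes "prime p"
    and "\<not> DCI_group (Zp_power p r)"
  shows "\<not> CI_group (Zp_power p (r + 3))"
proof
  have pos: "p > 0" using assms(1) prime_gt_0_nat by blast
  assume "CI_group (Zp_power p (r + 3))"
  then have CI: "CI_group (Zp_power p r \<times>\<times> Zp_power p 3)"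
    by (rule CI_group_iso[OF group_Zp_power DirProd_group[OF group_Zp_power group_Zp_power]
          Zp_power_add_iso[OF pos]])
  \<comment> \<open>For \<open>p = 2\<close> the sign vectors all collapse to (1,1,1) and leave no
    room for separate layers, hence the case split.\<close>
  have "DCI_group (Zp_power p r)"
  proof (cases "p = 2")
    case True
    show ?thesis
      using CI_group_DirProd_left[OF group_Zp_power group_Zp_power finite_Zp_power[OF pos] CI]
        DCI_group_Zp_power_2 True by simp
  next
    case False
    show ?thesis
      by (rule DCI_group_of_CI_group_DirProd_Zp_power_3[OF comm_group_Zp_power
            finite_Zp_power[OF pos] assms(1) False CI])
  qed
  with assms(2) show False ..
qed

end
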